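(* Let $0<\gamma<1$, let $T\ge R_0^2/\nu$, and suppose that $$\sigma_0< c\,\gamma\,R_0,\qquad c=\frac{1}{\sqrt{C_0K_1K_2}}.$$ Then for every $R$ with $$\frac{1}{c\gamma}\,\sigma_0\le R\le R_0,$$ the averaged enstrophy flux $\Psi_R$, computed with respect to an optimal covering of $B(\mathbf 0,R_0)$ by balls of radius $R$, satisfies $$c_{0,\gamma}\,\nu P_0\le\Psi_R\le c_{1,\gamma}\,\nu P_0,$$ where $$c_{0,\gamma}=\frac{1-\gamma^2}{K_1},\qquad c_{1,\gamma}=K_2\left[1+\frac{\gamma^2}{K_1K_2}\right].$$
   Context: Solution. $\nu>0$; $\Omega\subset\mathbb{R}^2$ is a bounded open connected set; $R_0>0$ is such that $B(\mathbf 0,3R_0)\subset\Omega$. $B(\mathbf x,r)$ and $S(\mathbf x,r)$ are the ball and the sphere (circle) of center $\mathbf x$ and radius $r$ in $\mathbb{R}^2$. $(\mathbf u,p)$, $\mathbf u=(u_1,u_2)$, is a smooth solution on $(0,\infty)\times\Omega$ of $\partial_t\mathbf u-\nu\Delta\mathbf u+(\mathbf u\cdot\nabla)\mathbf u+\nabla p=0$, $\nabla\cdot\mathbf u=0$, with no-slip boundary condition $\mathbf u|_{\partial\Omega}=0$. The vorticity is the scalar $\omega=\partial_1u_2-\partial_2u_1$, which satisfies $\partial_t\omega-\nu\Delta\omega+(\mathbf u\cdot\nabla)\omega=0$. Cut-offs. $1/2\le\delta<1$ and $C_0>0$ are fixed constants; $\mathcal D(U)$ denotes the smooth functions with compact support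 in $U$. Quotients below are understood where the denominator is nonzero, and $\phi^{2\delta-1}$ is read as $0$ where $\phi=0$. - $\psi_0\in\mathcal D(B(\mathbf 0,2R_0))$, $0\le\psi_0\le1$, $\psi_0=1$ on $B(\mathbf 0,R_0)$, $|\nabla\psi_0|/\psi_0^{\delta}\le C_0/R_0$, $|\Delta\psi_0|/\psi_0^{2\delta-1}\le C_0/R_0^2$. - For $T>0$: $\eta\in\mathcal D((0,2T))$, $0\le\eta\le1$, $\eta=1$ on $(T/4,5T/4)$, $|\eta'|/\eta^\delta\le C_0/T$. - For $\mathbf x_0\in B(\mathbf 0,R_0)$ and $0<R\le R_0$: $\psi=\psi_{\mathbf x_0,R}$ is smooth with $0\le\psi\le\psi_0$, $\psi=1$ on $B(\mathbf x_0,R)\cap B(\mathbf 0,R_0)$, $|\nabla\psi|/\psi^\delta\le C_0/R$, $|\Delta\psi|/\psi^{2\delta-1}\le C_0/R^2$. If $B(\mathbf x_0,R)\subset B(\mathbf 0,R_0)$, then $\psi\in\mathcal D(B(\mathbf x_0,2R))$. If $B(\mathbf x_0,R)\not\subset B(\mathbf 0,R_0)$, then $\psi\in\mathcal D(B(\mathbf 0,2R_0))$ and additionally: $\psi=\psi_0$ on $\{s\mathbf y:\mathbf y\in S(\mathbf 0,R_0)\cap B(\mathbf x_0,R),\,1\le s\le2\}$; $\psi=0$ on $B(\mathbf 0,R_0)\setminus B(\mathbf x_0,2R)$; and $\psi=0$ at those points of $\{R_0\le|\mathbf x|\le2R_0\}$ that do not lie in $\{s\mathbf y:\mathbf y\in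 S(\mathbf 0,R_0)\cap B(\mathbf x_0,2R),\,1\le s\le2\}$. - $\phi_{\mathbf x_0,R}(t,\mathbf x)=\eta(t)\psi_{\mathbf x_0,R}(\mathbf x)$ and $\phi_0(t,\mathbf x)=\eta(t)\psi_0(\mathbf x)$. Optimal coverings. $K_1,K_2>1$ are absolute constants (large enough that optimal coverings exist for all $0<R\le R_0$). A covering $\{B(\mathbf x_i,R)\}_{i=1}^n$ of $B(\mathbf 0,R_0)$, with $\mathbf x_i\in B(\mathbf 0,R_0)$, is optimal if $(R_0/R)^2\le n\le K_1(R_0/R)^2$ and every $\mathbf x\in B(\mathbf 0,R_0)$ belongs to at most $K_2$ of the balls $B(\mathbf x_i,2R)$. Averages (time integrals are over $(0,2T)$). $$\Psi_{\mathbf x_0,R}(t)=\int\tfrac12|\omega|^2\,\mathbf u\cdot\nabla\phi_{\mathbf x_0,R}\,d\mathbf x,\qquad \Psi_R=\frac1T\int\frac1n\sum_{i=1}^n\frac1{R^2}\Psi_{\mathbf x_i,R}(t)\,dt,$$ $$E_0=\frac1T\frac1{R_0^2}\iint\tfrac12|\omega|^2\phi_0^{2\delta-1}\,d\mathbf x\,dt,\qquad P_0=\frac1T\frac1{R_0^2}\iint|\nabla\omega|^2\phi_0\,d\mathbf x\,dt,$$ and $\sigma_0=(E_0/P_0)^{1/2}$ (Kraichnan length scale; it is understood that $P_0>0$).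
   Formalization: The cut-off attached to the ball B(0,R_0) itself is taken to be ψ_0, i.e. ψ_{0,R_0}=ψ_0; otherwise, for R=R_0 and the covering of B(0,R_0) by itself, ψ could vanish where most of P_0 is concentrated and the lower bound would fail. *)

theory Defs
  imports "HOL-Analysis.Analysis"
begin

section \<open>Smooth functions and differential operators\<close>

text \<open>Meant for open \<open>S\<close>: all iterated directional derivatives of order at most \<open>k\<close>
  exist and are continuous on \<open>S\<close>.\<close>

primrec Ck_on :: "nat \<Rightarrow> 'a::euclidean_space set \<Rightarrow> ('a \<Rightarrow> 'b::real_normed_vector) \<Rightarrow> bool" where
  "Ck_on 0 S f \<longleftrightarrow> continuous_on S f"
| "Ck_on (Suc k) S f \<longleftrightarrow>
     (\<forall>x\<in>S. f differentiable (at x)) \<and> (\<forall>v. Ck_on k S (\<lambda>x. frechet_derivative f (at x) v))"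

definition smooth_on :: "'a::euclidean_space set \<Rightarrow> ('a \<Rightarrow> 'b::real_normed_vector) \<Rightarrow> bool" where
  "smooth_on S f \<longleftrightarrow> (\<forall>k. Ck_on k S f)"

text \<open>The class \<open>\<D>(U)\<close> of smooth functions with compact support in \<open>U\<close>; its members are
  taken to be defined on the whole space, vanishing outside \<open>U\<close>.\<close>

definition test_function :: "'a::euclidean_space set \<Rightarrow> ('a \<Rightarrow> real) \<Rightarrow> bool" where
  "test_function U f \<longleftrightarrow>
     smooth_on UNIV f \<and> compact (closure {x. f x \<noteq> 0}) \<and> closure {x. f x \<noteq> 0} \<subseteq> U"

type_synonym plane = "real^2"

definition partial :: "2 \<Rightarrow> (plane \<Rightarrow> 'b::real_normed_vector) \<Rightarrow> plane \<Rightarrow> 'b" where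
  "partial j f x = frechet_derivative f (at x) (axis j 1)"

definition grad :: "(plane \<Rightarrow> real) \<Rightarrow> plane \<Rightarrow> plane" where
  "grad f x = (\<chi> j. partial j f x)"

definition laplacian :: "(plane \<Rightarrow> 'b::real_normed_vector) \<Rightarrow> plane \<Rightarrow> 'b" where
  "laplacian f x = (\<Sum>j\<in>UNIV. partial j (partial j f) x)"

definition divergence :: "(plane \<Rightarrow> plane) \<Rightarrow> plane \<Rightarrow> real" where
  "divergence v x = (\<Sum>j\<in>UNIV. partial j (\<lambda>y. v y $ j) x)"

definition curl :: "(plane \<Rightarrow> plane) \<Rightarrow> plane \<Rightarrow> real" where
  "curl v x = partial 1 (\<lambda>y. v y $ 2) x - partial 2 (\<lambda>y. v y $ 1) x"

section \<open>The Navier--Stokes system\<close>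

text \<open>The no-slip condition is imposed through the limit of \<open>u t\<close> at the boundary, so it does
  not depend on the values of \<open>u\<close> outside \<open>\<Omega>\<close>.\<close>

definition NS_solution ::
  "real \<Rightarrow> plane set \<Rightarrow> (real \<Rightarrow> plane \<Rightarrow> plane) \<Rightarrow> (real \<Rightarrow> plane \<Rightarrow> real) \<Rightarrow> bool" where
  "NS_solution \<nu> \<Omega> u p \<longleftrightarrow>
     smooth_on ({0<..} \<times> \<Omega>) (\<lambda>(t, x). u t x) \<and>
     smooth_on ({0<..} \<times> \<Omega>) (\<lambda>(t, x). p t x) \<and>
     (\<forall>t>0. \<forall>x\<in>\<Omega>.
        vector_derivative (\<lambda>s. u s x) (at t) - \<nu> *\<^sub>R laplacian (u t) x
          + (\<Sum>j\<in>UNIV. (u t x $ j) *\<^sub>R partial j (u t) x) + grad (p t) x = 0 \<and>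
        divergence (u t) x = 0) \<and>
     (\<forall>t>0. \<forall>y\<in>frontier \<Omega>. (u t \<longlongrightarrow> 0) (at y within \<Omega>))"

section \<open>Cut-offs\<close>

text \<open>Since \<open>a / 0 = 0\<close> and \<open>0 powr a = 0\<close> (also for \<open>a = 0\<close>), the bounds on quotients below
  constrain exactly the points where the cut-off is nonzero.\<close>

definition spatial_bounds :: "real \<Rightarrow> real \<Rightarrow> real \<Rightarrow> (plane \<Rightarrow> real) \<Rightarrow> bool" where
  "spatial_bounds \<delta> C0 R \<psi> \<longleftrightarrow>
     (\<forall>x. norm (grad \<psi> x) / \<psi> x powr \<delta> \<le> C0 / R) \<and>
     (\<forall>x. \<bar>laplacian \<psi> x\<bar> / \<psi> x powr (2 * \<delta> - 1) \<le> C0 / R\<^sup>2)"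

definition macro_cutoff :: "real \<Rightarrow> real \<Rightarrow> real \<Rightarrow> (plane \<Rightarrow> real) \<Rightarrow> bool" where
  "macro_cutoff \<delta> C0 R0 \<psi>0 \<longleftrightarrow>
     test_function (ball 0 (2 * R0)) \<psi>0 \<and> (\<forall>x. 0 \<le> \<psi>0 x \<and> \<psi>0 x \<le> 1) \<and>
     (\<forall>x\<in>ball 0 R0. \<psi>0 x = 1) \<and> spatial_bounds \<delta> C0 R0 \<psi>0"

definition time_cutoff :: "real \<Rightarrow> real \<Rightarrow> real \<Rightarrow> (real \<Rightarrow> real) \<Rightarrow> bool" where
  "time_cutoff \<delta> C0 T \<eta> \<longleftrightarrow>
     test_function {0<..<2 * T} \<eta> \<and> (\<forall>t. 0 \<le> \<eta> t \<and> \<eta> t \<le> 1) \<and>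
     (\<forall>t\<in>{T / 4<..<5 * T / 4}. \<eta> t = 1) \<and>
     (\<forall>t. \<bar>deriv \<eta> t\<bar> / \<eta> t powr \<delta> \<le> C0 / T)"

text \<open>The part between \<open>S(0,R0)\<close> and \<open>S(0,2R0)\<close> of the cone over \<open>S(0,R0) \<inter> B(x0,r)\<close>.\<close>

definition cone_shell :: "real \<Rightarrow> plane \<Rightarrow> real \<Rightarrow> plane set" where
  "cone_shell R0 x0 r = {s *\<^sub>R y |s y. y \<in> sphere 0 R0 \<inter> ball x0 r \<and> 1 \<le> s \<and> s \<le> 2}"

definition local_cutoff ::
  "real \<Rightarrow> real \<Rightarrow> real \<Rightarrow> (plane \<Rightarrow> real) \<Rightarrow> plane \<Rightarrow> real \<Rightarrow> (plane \<Rightarrow> real) \<Rightarrow> bool" where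
  "local_cutoff \<delta> C0 R0 \<psi>0 x0 R \<psi> \<longleftrightarrow>
     smooth_on UNIV \<psi> \<and> (\<forall>x. 0 \<le> \<psi> x \<and> \<psi> x \<le> \<psi>0 x) \<and>
     (\<forall>x \<in> ball x0 R \<inter> ball 0 R0. \<psi> x = 1) \<and> spatial_bounds \<delta> C0 R \<psi> \<and>
     (ball x0 R \<subseteq> ball 0 R0 \<longrightarrow> test_function (ball x0 (2 * R)) \<psi>) \<and>
     (\<not> ball x0 R \<subseteq> ball 0 R0 \<longrightarrow>
        test_function (ball 0 (2 * R0)) \<psi> \<and>
        (\<forall>x \<in> cone_shell R0 x0 R. \<psi> x = \<psi>0 x) \<and>
        (\<forall>x \<in> ball 0 R0 - ball x0 (2 * R). \<psi> x = 0) \<and>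
        (\<forall>x. R0 \<le> norm x \<and> norm x \<le> 2 * R0 \<and> x \<notin> cone_shell R0 x0 (2 * R) \<longrightarrow> \<psi> x = 0))"

text \<open>\<open>\<psi> x0 R\<close> is the cut-off attached to \<open>B(x0,R)\<close>.  The last clause fixes the member attached to
  \<open>B(0,R0)\<close> itself: it is \<open>\<psi>0\<close>, so that the quantities with index \<open>0\<close> are those of this ball.
  For this single ball the other clauses say nothing about the size of the cut-off on
  \<open>R0 < |x| < 2R0\<close>, and the covering of \<open>B(0,R0)\<close> by itself would not control \<open>\<psi>0\<close> there.\<close>

definition cutoff_family ::
  "real \<Rightarrow> real \<Rightarrow> real \<Rightarrow> (plane \<Rightarrow> real) \<Rightarrow> (plane \<Rightarrow> real \<Rightarrow> plane \<Rightarrow> real) \<Rightarrow> bool" where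
  "cutoff_family \<delta> C0 R0 \<psi>0 \<psi> \<longleftrightarrow>
     (\<forall>x0\<in>ball 0 R0. \<forall>R. 0 < R \<and> R \<le> R0 \<longrightarrow> local_cutoff \<delta> C0 R0 \<psi>0 x0 R (\<psi> x0 R)) \<and>
     \<psi> 0 R0 = \<psi>0"

definition cutoff :: "(real \<Rightarrow> real) \<Rightarrow> (plane \<Rightarrow> real) \<Rightarrow> real \<Rightarrow> plane \<Rightarrow> real" where
  "cutoff \<eta> \<psi> t x = \<eta> t * \<psi> x"

section \<open>Optimal coverings\<close>

text \<open>The covering is a family indexed by \<open>{1..n}\<close>; balls are counted with multiplicity.\<close>

definition optimal_covering ::
  "real \<Rightarrow> real \<Rightarrow> real \<Rightarrow> real \<Rightarrow> nat \<Rightarrow> (nat \<Rightarrow> plane) \<Rightarrow> bool" where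
  "optimal_covering K1 K2 R0 R n x \<longleftrightarrow>
     (\<forall>i\<in>{1..n}. x i \<in> ball 0 R0) \<and>
     ball 0 R0 \<subseteq> (\<Union>i\<in>{1..n}. ball (x i) R) \<and>
     (R0 / R)\<^sup>2 \<le> real n \<and> real n \<le> K1 * (R0 / R)\<^sup>2 \<and>
     (\<forall>y\<in>ball 0 R0. real (card {i\<in>{1..n}. y \<in> ball (x i) (2 * R)}) \<le> K2)"

section \<open>Fluxes and averages\<close>

definition flux ::
  "plane set \<Rightarrow> (real \<Rightarrow> plane \<Rightarrow> plane) \<Rightarrow> (real \<Rightarrow> plane \<Rightarrow> real) \<Rightarrow> real \<Rightarrow> real" where
  "flux \<Omega> u \<phi> t =
     (LINT x:\<Omega>|lborel. 1 / 2 * \<bar>curl (u t) x\<bar>\<^sup>2 * (u t x \<bullet> grad (\<phi> t) x))"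

definition averaged_flux ::
  "plane set \<Rightarrow> (real \<Rightarrow> plane \<Rightarrow> plane) \<Rightarrow> real \<Rightarrow> (real \<Rightarrow> real) \<Rightarrow>
   (plane \<Rightarrow> real \<Rightarrow> plane \<Rightarrow> real) \<Rightarrow> real \<Rightarrow> nat \<Rightarrow> (nat \<Rightarrow> plane) \<Rightarrow> real" where
  "averaged_flux \<Omega> u T \<eta> \<psi> R n x =
     1 / T * (LINT t:{0<..<2 * T}|lborel.
       1 / real n * (\<Sum>i=1..n. 1 / R\<^sup>2 * flux \<Omega> u (cutoff \<eta> (\<psi> (x i) R)) t))"

definition enstrophy0 ::
  "plane set \<Rightarrow> (real \<Rightarrow> plane \<Rightarrow> plane) \<Rightarrow> real \<Rightarrow> real \<Rightarrow> real \<Rightarrow> (real \<Rightarrow> plane \<Rightarrow> real) \<Rightarrow> real" where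
  "enstrophy0 \<Omega> u \<delta> T R0 \<phi>0 =
     1 / T * (1 / R0\<^sup>2) * (LINT t:{0<..<2 * T}|lborel. LINT x:\<Omega>|lborel.
       1 / 2 * \<bar>curl (u t) x\<bar>\<^sup>2 * \<phi>0 t x powr (2 * \<delta> - 1))"

definition palinstrophy0 ::
  "plane set \<Rightarrow> (real \<Rightarrow> plane \<Rightarrow> plane) \<Rightarrow> real \<Rightarrow> real \<Rightarrow> (real \<Rightarrow> plane \<Rightarrow> real) \<Rightarrow> real" where
  "palinstrophy0 \<Omega> u T R0 \<phi>0 =
     1 / T * (1 / R0\<^sup>2) * (LINT t:{0<..<2 * T}|lborel. LINT x:\<Omega>|lborel.
       (norm (grad (curl (u t)) x))\<^sup>2 * \<phi>0 t x)"

end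

theory Submission
  imports Defs
begin

text \<open>
  Multiplying the vorticity equation by \<open>\<omega> \<phi>\<close> and integrating by parts over space-time shows, for
  each cut-off \<open>\<phi>(t,x) = \<eta>(t) \<psi>(x)\<close>, that the time integral of the flux is the dissipation
  \<open>\<nu> \<integral>|\<nabla>\<omega>|\<^sup>2 \<phi>\<close> minus the production \<open>\<integral> \<omega>\<^sup>2/2 (\<partial>\<^sub>t \<phi> + \<nu> \<Delta>\<phi>)\<close> by the cut-off
  (\<open>time_integrated_flux\<close>). This is summed over the cut-offs \<open>\<psi>\<^sub>i\<close> of an optimal covering and divided by
  \<open>T n R\<^sup>2\<close>.

  The dissipation is the main term. Almost everywhere \<open>\<psi>0 \<le> \<Sum> \<psi>\<^sub>i \<le> K2 \<psi>0\<close> (\<open>AE_sum_cutoffs\<close>), and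
  \<open>R0\<^sup>2 \<le> n R\<^sup>2 \<le> K1 R0\<^sup>2\<close>, so it lies between \<open>\<nu> P0 / K1\<close> and \<open>K2 \<nu> P0\<close>.

  The production has to be at most \<open>\<gamma>\<^sup>2 \<nu> P0 / K1\<close>. Since the hypothesis on \<open>R\<close> bounds \<open>E0 / R\<^sup>2\<close> by
  \<open>\<gamma>\<^sup>2 P0 / (C0 K1 K2)\<close>, this amounts to the pointwise bound
  \<open>|\<Sum> (\<partial>\<^sub>t + \<nu> \<Delta>)(\<eta> \<psi>\<^sub>i)| \<le> n K2 (\<nu> C0 / R0\<^sup>2) (\<eta> \<psi>0)\<^bsup>2\<delta>-1\<^esup>\<close>
  (\<open>AE_cutoff_production_bound\<close>). At most \<open>K2\<close> cut-offs act at a point. Each of them contributes one unit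
  \<open>\<nu> C0 / R0\<^sup>2\<close> by its time derivative, because \<open>T \<ge> R0\<^sup>2 / \<nu>\<close>, and \<open>(R0/R)\<^sup>2 \<le> n\<close> units by its Laplacian.
  This gives \<open>K2 (n + 1)\<close> instead of \<open>K2 n\<close>. The excess is compensated by the cut-off that
  coincides with \<open>\<psi>0\<close> near the point (\<open>AE_local_cutoff_eq_macro\<close>): its Laplacian contributes nothing inside
  \<open>B(0,R0)\<close> and one unit outside, instead of \<open>(R0/R)\<^sup>2\<close>. With \<open>m\<close> active cut-offs this suffices inside the
  ball because \<open>m \<le> n\<close>, and outside if \<open>m < n\<close>. If all cut-offs are active at a point outside, then
  \<open>R \<ge> 2 R0 / 3\<close>, and \<open>K2 \<ge> 4\<close> leaves enough room; the latter holds because optimal coverings exist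
  for all radii.

  The pointwise bounds hold only almost everywhere: the quotient bounds say nothing where a cut-off
  vanishes, and the open balls cover \<open>B(0,R0)\<close> but possibly not all of its boundary. The exceptional sets
  are null because they meet the lines of a suitable direction in countable sets
  (\<open>null_set_if_countable_line_sections\<close>).
\<close>

section \<open>Directional derivatives of smooth functions\<close>

abbreviation dderiv :: "'a::euclidean_space \<Rightarrow> ('a \<Rightarrow> 'b::real_normed_vector) \<Rightarrow> 'a \<Rightarrow> 'b" where
  "dderiv v f \<equiv> (\<lambda>x. frechet_derivative f (at x) v)"

lemma smooth_on_differentiable: "smooth_on S f \<Longrightarrow> x \<in> S \<Longrightarrow> f differentiable at x"
  unfolding smooth_on_def by (metis Ck_on.simps(2))

lemma smooth_on_dderiv: "smooth_on S f \<Longrightarrow> smooth_on S (dderiv v f)"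
  unfolding smooth_on_def by (metis Ck_on.simps(2))

lemma smooth_on_continuous: "smooth_on S f \<Longrightarrow> continuous_on S f"
  unfolding smooth_on_def by (metis Ck_on.simps(1))

lemma dderiv_cong_open:
  assumes "open S" "x \<in> S" "\<And>y. y \<in> S \<Longrightarrow> f y = g y"
  shows "dderiv v f x = dderiv v g x"
proof (cases "f differentiable at x")
  case True
  then show ?thesis
    using frechet_derivative_transform_within_open[OF True assms(1,2,3)] by simp
next
  case False
  then have "(f has_derivative D) (at x) \<longleftrightarrow> (g has_derivative D) (at x)" for D
    using has_derivative_transform_within_open[OF _ assms(1-3)]
      has_derivative_transform_within_open[OF _ assms(1,2) assms(3)[symmetric]] by auto
  then show ?thesis by (simp add: frechet_derivative_def)
qed

lemma Ck_on_cong_open: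
  assumes "open S" "\<And>x. x \<in> S \<Longrightarrow> f x = g x"
  shows "Ck_on k S f \<longleftrightarrow> Ck_on k S g"
  using assms(2)
proof (induction k arbitrary: f g)
  case 0
  then show ?case by (simp cong: continuous_on_cong)
next
  case (Suc k)
  have "f differentiable at x \<longleftrightarrow> g differentiable at x" if "x \<in> S" for x
    unfolding differentiable_def
    using has_derivative_transform_within_open[OF _ assms(1) that Suc.prems, of "\<lambda>y. y"]
      has_derivative_transform_within_open[OF _ assms(1) that Suc.prems[symmetric], of "\<lambda>y. y"] by blast
  moreover have "Ck_on k S (dderiv v f) \<longleftrightarrow> Ck_on k S (dderiv v g)" for v
    using dderiv_cong_open[OF assms(1) _ Suc.prems] by (intro Suc.IH) auto
  ultimately show ?case by simp
qed

lemma smooth_on_cong_open: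
  "open S \<Longrightarrow> (\<And>x. x \<in> S \<Longrightarrow> f x = g x) \<Longrightarrow> smooth_on S f \<longleftrightarrow> smooth_on S g"
  unfolding smooth_on_def using Ck_on_cong_open by blast

lemma has_derivative_frechet: "f differentiable at x \<Longrightarrow> (f has_derivative (\<lambda>v. dderiv v f x)) (at x)"
  using frechet_derivative_works by blast

lemma dderiv_bounded_linear:
  assumes "bounded_linear L" "f differentiable at x"
  shows "dderiv v (\<lambda>y. L (f y)) x = L (dderiv v f x)"
proof -
  have "((\<lambda>y. L (f y)) has_derivative (\<lambda>v. L (dderiv v f x))) (at x)"
    using bounded_linear.has_derivative[OF assms(1) has_derivative_frechet[OF assms(2)]] .
  from frechet_derivative_at[OF this] show ?thesis by (rule fun_cong[symmetric])
qed

lemma dderiv_diff: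
  assumes "f differentiable at x" "g differentiable at x"
  shows "dderiv v (\<lambda>y. f y - g y) x = dderiv v f x - dderiv v g x"
proof -
  have "((\<lambda>y. f y - g y) has_derivative (\<lambda>v. dderiv v f x - dderiv v g x)) (at x)"
    using assms by (intro has_derivative_diff has_derivative_frechet)
  from frechet_derivative_at[OF this] show ?thesis by (rule fun_cong[symmetric])
qed

lemma smooth_on_bounded_linear:
  fixes f :: "'a::euclidean_space \<Rightarrow> 'b::real_normed_vector"
  assumes "open S" "bounded_linear L" "smooth_on S f"
  shows "smooth_on S (\<lambda>x. L (f x))"
proof -
  have "Ck_on k S (\<lambda>x. L (f x))" if "smooth_on S f" for k and f :: "'a \<Rightarrow> 'b"
    using that
  proof (induction k arbitrary: f)
    case 0
    then show ?case
      using bounded_linear.continuous_on[OF assms(2)] smooth_on_continuous by auto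
  next
    case (Suc k)
    have d: "f differentiable at x" if "x \<in> S" for x
      using Suc.prems smooth_on_differentiable that by blast
    have "Ck_on k S (dderiv v (\<lambda>x. L (f x)))" for v
      using iffD2[OF Ck_on_cong_open[OF assms(1) dderiv_bounded_linear[OF assms(2) d]]
        Suc.IH[OF smooth_on_dderiv[OF Suc.prems]]] .
    moreover have "(\<lambda>x. L (f x)) differentiable at x" if "x \<in> S" for x
      using bounded_linear.has_derivative[OF assms(2) has_derivative_frechet[OF d[OF that]]]
      unfolding differentiable_def by blast
    ultimately show ?case by simp
  qed
  with assms(3) show ?thesis unfolding smooth_on_def[of S "\<lambda>x. L (f x)"] by blast
qed

lemma smooth_on_diff:
  fixes f g :: "'a::euclidean_space \<Rightarrow> 'b::real_normed_vector"
  assumes "open S" "smooth_on S f" "smooth_on S g"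
  shows "smooth_on S (\<lambda>x. f x - g x)"
proof -
  have "Ck_on k S (\<lambda>x. f x - g x)" if "smooth_on S f" "smooth_on S g" for k and f g :: "'a \<Rightarrow> 'b"
    using that
  proof (induction k arbitrary: f g)
    case 0
    then show ?case by (simp add: continuous_on_diff smooth_on_continuous)
  next
    case (Suc k)
    have d: "f differentiable at x" "g differentiable at x" if "x \<in> S" for x
      using Suc.prems smooth_on_differentiable that by blast+
    have "Ck_on k S (dderiv v (\<lambda>x. f x - g x))" for v
      using iffD2[OF Ck_on_cong_open[OF assms(1) dderiv_diff[OF d]]
        Suc.IH[OF Suc.prems[THEN smooth_on_dderiv]]] .
    then show ?case using d by simp
  qed
  with assms(2,3) show ?thesis unfolding smooth_on_def[of S "\<lambda>x. f x - g x"] by blast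
qed

lemma has_real_derivative_along_line:
  fixes f :: "'a::euclidean_space \<Rightarrow> real"
  assumes "f differentiable at (x + s *\<^sub>R v)"
  shows "((\<lambda>r. f (x + r *\<^sub>R v)) has_real_derivative dderiv v f (x + s *\<^sub>R v)) (at s)"
proof -
  have "((\<lambda>r. x + r *\<^sub>R v) has_derivative (\<lambda>r. r *\<^sub>R v)) (at s)"
    by (auto intro!: derivative_eq_intros)
  from diff_chain_at[OF this has_derivative_frechet[OF assms]]
  have "((\<lambda>r. f (x + r *\<^sub>R v)) has_derivative (\<lambda>r. dderiv (r *\<^sub>R v) f (x + s *\<^sub>R v))) (at s)"
    by (simp add: o_def)
  moreover have "dderiv (r *\<^sub>R v) f (x + s *\<^sub>R v) = dderiv v f (x + s *\<^sub>R v) * r" for r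
    using linear_frechet_derivative[OF assms] by (simp add: linear_scale)
  ultimately show ?thesis unfolding has_field_derivative_def by simp
qed

text \<open>Both iterated derivatives are limits of the second difference quotient
  \<open>(f(x+hv+hw) - f(x+hv) - f(x+hw) + f(x)) / h\<^sup>2\<close>: two applications of the mean value theorem,
  taken in either order, express it as a value of either of them near \<open>x\<close>.\<close>

lemma second_difference_mean_value:
  fixes f :: "'a::euclidean_space \<Rightarrow> real"
  assumes f: "smooth_on (ball x e) f" and h: "0 < h" "h * (norm v + norm w) < e"
  shows "\<exists>y. dist x y \<le> h * (norm v + norm w) \<and>
    f (x + h *\<^sub>R v + h *\<^sub>R w) - f (x + h *\<^sub>R v) - f (x + h *\<^sub>R w) + f x = h\<^sup>2 * dderiv w (dderiv v f) y"
proof -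
  have close: "dist x (x + s *\<^sub>R v + r *\<^sub>R w) \<le> h * (norm v + norm w)"
    if "0 \<le> s" "s \<le> h" "0 \<le> r" "r \<le> h" for s r
  proof -
    have "norm (s *\<^sub>R v + r *\<^sub>R w) \<le> s * norm v + r * norm w"
      using that by (metis abs_of_nonneg norm_scaleR norm_triangle_ineq)
    also have "\<dots> \<le> h * norm v + h * norm w"
      using that by (intro add_mono mult_right_mono) auto
    finally show ?thesis
      by (simp add: dist_norm algebra_simps norm_minus_commute)
  qed
  have inb: "x + s *\<^sub>R v + r *\<^sub>R w \<in> ball x e" if "0 \<le> s" "s \<le> h" "0 \<le> r" "r \<le> h" for s r
    using close[OF that] h by simp
  define g where "g s = f (x + s *\<^sub>R v + h *\<^sub>R w) - f (x + s *\<^sub>R v)" for s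
  have dg: "(g has_real_derivative
      (dderiv v f (x + s *\<^sub>R v + h *\<^sub>R w) - dderiv v f (x + s *\<^sub>R v))) (at s)"
    if "0 \<le> s" "s \<le> h" for s
  proof -
    have *: "((\<lambda>r. f (x + r *\<^sub>R v + h *\<^sub>R w)) has_real_derivative dderiv v f (x + s *\<^sub>R v + h *\<^sub>R w)) (at s)"
      using has_real_derivative_along_line[of f "x + h *\<^sub>R w" s v]
        smooth_on_differentiable[OF f inb[OF that, of h]] h(1)
      by (simp add: algebra_simps)
    show ?thesis unfolding g_def
      using has_real_derivative_along_line[of f x s v]
        smooth_on_differentiable[OF f inb[OF that, of 0]] h(1)
      by (intro DERIV_diff *) simp
  qed
  from MVT2[OF h(1) dg] obtain \<xi> where \<xi>: "0 < \<xi>" "\<xi> < h"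
    "g h - g 0 = h * (dderiv v f (x + \<xi> *\<^sub>R v + h *\<^sub>R w) - dderiv v f (x + \<xi> *\<^sub>R v))" by auto
  have dk: "((\<lambda>r. dderiv v f (x + \<xi> *\<^sub>R v + r *\<^sub>R w)) has_real_derivative
      dderiv w (dderiv v f) (x + \<xi> *\<^sub>R v + r *\<^sub>R w)) (at r)" if "0 \<le> r" "r \<le> h" for r
    using has_real_derivative_along_line[of "dderiv v f" "x + \<xi> *\<^sub>R v" r w]
      smooth_on_differentiable[OF smooth_on_dderiv[OF f] inb[of \<xi> r]] \<xi> that by simp
  from MVT2[OF h(1) dk] obtain \<zeta> where \<zeta>: "0 < \<zeta>" "\<zeta> < h"
    "dderiv v f (x + \<xi> *\<^sub>R v + h *\<^sub>R w) - dderiv v f (x + \<xi> *\<^sub>R v) =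
      h * dderiv w (dderiv v f) (x + \<xi> *\<^sub>R v + \<zeta> *\<^sub>R w)" by auto
  show ?thesis
    using close[of \<xi> \<zeta>] \<xi> \<zeta> unfolding g_def
    by (intro exI[of _ "x + \<xi> *\<^sub>R v + \<zeta> *\<^sub>R w"]) (auto simp: power2_eq_square algebra_simps)
qed

lemma Clairaut:
  fixes f :: "'a::euclidean_space \<Rightarrow> real"
  assumes "open S" "smooth_on S f" "x \<in> S"
  shows "dderiv w (dderiv v f) x = dderiv v (dderiv w f) x"
proof -
  let ?a = "dderiv w (dderiv v f)" and ?b = "dderiv v (dderiv w f)"
  obtain e where e: "0 < e" "ball x e \<subseteq> S" using assms(1,3) open_contains_ball by blast
  have sub: "smooth_on (ball x e) f"
  proof -
    have "Ck_on k (ball x e) g" if "Ck_on k S g" for k and g :: "'a \<Rightarrow> real"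
      using that by (induction k arbitrary: g) (use e(2) in \<open>auto intro: continuous_on_subset\<close>)
    with assms(2) show ?thesis unfolding smooth_on_def by blast
  qed
  \<comment> \<open>step sizes tending to \<open>0\<close> for which all points of the second difference stay in the ball\<close>
  define q where "q n = e / 2 / ((norm v + norm w + 1) * real (Suc n))" for n
  have q: "0 < q n" "q n * (norm v + norm w) < e" for n
  proof -
    have p: "0 < (norm v + norm w + 1) * real (Suc n)" by (intro mult_pos_pos) (auto intro: add_nonneg_pos)
    show "0 < q n" unfolding q_def using e(1) p by auto
    have "q n * (norm v + norm w) \<le> e / 2"
    proof -
      have "norm v + norm w \<le> (norm v + norm w + 1) * 1" by simp
      also have "\<dots> \<le> (norm v + norm w + 1) * real (Suc n)"
        by (rule mult_left_mono) (auto intro: add_nonneg_nonneg)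
      finally show ?thesis unfolding q_def using p e(1)
        by (simp add: divide_simps del: of_nat_Suc)
    qed
    with e(1) show "q n * (norm v + norm w) < e" by simp
  qed
  have lim0: "(\<lambda>n. q n * (norm v + norm w)) \<longlonglongrightarrow> 0"
  proof -
    have "(\<lambda>n. (e / 2 / (norm v + norm w + 1) * (norm v + norm w)) * inverse (real (Suc n))) \<longlonglongrightarrow> 0"
      by (rule tendsto_mult_right_zero[OF LIMSEQ_inverse_real_of_nat])
    then show ?thesis unfolding q_def by (simp add: field_simps)
  qed
  have "\<forall>n. \<exists>y. dist x y \<le> q n * (norm v + norm w) \<and>
    f (x + q n *\<^sub>R v + q n *\<^sub>R w) - f (x + q n *\<^sub>R v) - f (x + q n *\<^sub>R w) + f x = (q n)\<^sup>2 * ?a y"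
    using second_difference_mean_value[OF sub q] by blast
  then obtain y where y: "\<And>n. dist x (y n) \<le> q n * (norm v + norm w)"
    "\<And>n. f (x + q n *\<^sub>R v + q n *\<^sub>R w) - f (x + q n *\<^sub>R v) - f (x + q n *\<^sub>R w) + f x = (q n)\<^sup>2 * ?a (y n)"
    by metis
  have "\<forall>n. \<exists>z. dist x z \<le> q n * (norm v + norm w) \<and>
    f (x + q n *\<^sub>R v + q n *\<^sub>R w) - f (x + q n *\<^sub>R v) - f (x + q n *\<^sub>R w) + f x = (q n)\<^sup>2 * ?b z"
    using second_difference_mean_value[OF sub q(1), of _ w v] q(2)
    by (simp add: add.commute add.left_commute algebra_simps)
  then obtain z where z: "\<And>n. dist x (z n) \<le> q n * (norm v + norm w)"
    "\<And>n. f (x + q n *\<^sub>R v + q n *\<^sub>R w) - f (x + q n *\<^sub>R v) - f (x + q n *\<^sub>R w) + f x = (q n)\<^sup>2 * ?b (z n)"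
    by metis
  have eq: "?a (y n) = ?b (z n)" for n
  proof -
    have "(q n)\<^sup>2 * ?a (y n) = (q n)\<^sup>2 * ?b (z n)" using y(2) z(2) by metis
    with q(1)[of n] show ?thesis by simp
  qed
  have conv: "y' \<longlonglongrightarrow> x" if "\<And>n. dist x (y' n) \<le> q n * (norm v + norm w)" for y'
  proof -
    have "(\<lambda>n. dist (y' n) x) \<longlonglongrightarrow> 0"
      by (rule tendsto_sandwich[OF _ _ tendsto_const lim0]) (use that in \<open>auto simp: dist_commute\<close>)
    then show ?thesis using tendsto_dist_iff by blast
  qed
  have cont: "isCont ?a x" "isCont ?b x"
    using continuous_on_eq_continuous_at[OF assms(1)] assms(3)
      smooth_on_continuous[OF smooth_on_dderiv[OF smooth_on_dderiv[OF assms(2)]]] by auto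
  have la: "(\<lambda>n. ?a (y n)) \<longlonglongrightarrow> ?a x"
    by (rule isCont_tendsto_compose[OF cont(1) conv[OF y(1)]])
  have "(\<lambda>n. ?b (z n)) \<longlonglongrightarrow> ?b x"
    by (rule isCont_tendsto_compose[OF cont(2) conv[OF z(1)]])
  then have lb: "(\<lambda>n. ?a (y n)) \<longlonglongrightarrow> ?b x" unfolding eq .
  show ?thesis by (rule LIMSEQ_unique[OF la lb])
qed

section \<open>Integration on Euclidean spaces\<close>

lemma continuous_on_mult_supported:
  fixes f g :: "'a::topological_space \<Rightarrow> real"
  assumes "open S" "closed K" "K \<subseteq> S" "continuous_on S f" "continuous_on UNIV g"
    and "\<And>x. x \<notin> K \<Longrightarrow> g x = 0"
  shows "continuous_on UNIV (\<lambda>x. f x * g x)"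
proof -
  have "continuous_on (- K) (\<lambda>x. f x * g x) \<longleftrightarrow> continuous_on (- K) (\<lambda>x. 0::real)"
    using assms(6) by (intro continuous_on_cong) auto
  then have "continuous_on (S \<union> - K) (\<lambda>x. f x * g x)"
    using assms
    by (intro continuous_on_open_Un) (auto intro!: continuous_on_mult intro: continuous_on_subset[of UNIV])
  moreover have "S \<union> - K = UNIV" using assms(3) by auto
  ultimately show ?thesis by metis
qed

lemma integrable_mult_supported:
  fixes f g :: "'a::euclidean_space \<Rightarrow> real"
  assumes "compact K" "continuous_on K f" "g \<in> borel_measurable borel"
    and "\<And>x. \<bar>g x\<bar> \<le> B" "\<And>x. x \<notin> K \<Longrightarrow> g x = 0"
  shows "integrable lborel (\<lambda>x. f x * g x)"
proof -
  have i: "integrable lborel (\<lambda>x. indicator K x *\<^sub>R f x)"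
    using borel_integrable_compact assms by blast
  have "integrable lborel (\<lambda>x. (indicator K x *\<^sub>R f x) * g x)"
  proof (rule Bochner_Integration.integrable_bound)
    show "integrable lborel (\<lambda>x. B * (indicator K x *\<^sub>R f x))" using i by simp
    show "(\<lambda>x. (indicator K x *\<^sub>R f x) * g x) \<in> borel_measurable lborel"
      using borel_measurable_integrable[OF i] assms(3) by simp
    have "\<bar>f x\<bar> * \<bar>g x\<bar> \<le> \<bar>f x\<bar> * \<bar>B\<bar>" for x
      using assms(4)[of x] by (intro mult_left_mono) auto
    then show "AE x in lborel. norm ((indicator K x *\<^sub>R f x) * g x) \<le> norm (B * (indicator K x *\<^sub>R f x))"
      by (intro AE_I2) (simp add: abs_mult mult.commute split: split_indicator)
  qed
  moreover have "(\<lambda>x. (indicator K x *\<^sub>R f x) * g x) = (\<lambda>x. f x * g x)"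
    using assms(5) by (auto split: split_indicator)
  ultimately show ?thesis by (simp only:)
qed

lemma bounded_range_if_supported:
  fixes g :: "'a::topological_space \<Rightarrow> real"
  assumes "compact K" "continuous_on UNIV g" "\<And>x. x \<notin> K \<Longrightarrow> g x = 0"
  obtains B where "0 \<le> B" "\<And>x. \<bar>g x\<bar> \<le> B"
proof -
  have "bounded (g ` K)"
    by (intro compact_imp_bounded compact_continuous_image assms(1) continuous_on_subset[OF assms(2)]) simp
  then obtain b where "\<And>x. x \<in> K \<Longrightarrow> \<bar>g x\<bar> \<le> b" by (force simp: bounded_iff)
  then have "\<bar>g x\<bar> \<le> max b 0" for x using assms(3)[of x] by (cases "x \<in> K") (auto simp: le_max_iff_disj)
  then show ?thesis using that[of "max b 0"] by auto
qed

lemma integral_lborel_translate: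
  fixes F :: "'a::euclidean_space \<Rightarrow> real"
  assumes "F \<in> borel_measurable borel"
  shows "(\<integral>x. F (a + x) \<partial>lborel) = integral\<^sup>L lborel F"
proof -
  have "integral\<^sup>L (distr lborel borel ((+) a)) F = (\<integral>x. F (a + x) \<partial>lborel)"
    using assms by (intro integral_distr) auto
  then show ?thesis by (simp add: lborel_distr_plus)
qed

text \<open>The integral of the difference quotient \<open>(F(x + hv) - F(x)) / h\<close> vanishes because
  Lebesgue measure is translation invariant; the mean value theorem provides the domination
  that is needed to pass to the limit \<open>h \<rightarrow> 0\<close>.\<close>

lemma integral_directional_derivative_eq_0:
  fixes F G :: "'a::euclidean_space \<Rightarrow> real"
  assumes d: "\<And>x. ((\<lambda>s. F (x + s *\<^sub>R v)) has_real_derivative G x) (at 0)"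
    and F: "continuous_on UNIV F" and G: "continuous_on UNIV G"
    and K: "compact K" "\<And>x. x \<notin> K \<Longrightarrow> F x = 0" "\<And>x. x \<notin> K \<Longrightarrow> G x = 0"
  shows "integral\<^sup>L lborel G = 0"
proof -
  obtain L where L: "0 \<le> L" "\<And>x. \<bar>G x\<bar> \<le> L"
    using bounded_range_if_supported[OF K(1) G K(3)] by blast
  obtain \<rho> where \<rho>: "\<And>x. x \<in> K \<Longrightarrow> norm x \<le> \<rho>"
    using compact_imp_bounded[OF K(1)] unfolding bounded_iff by blast
  have mF: "F \<in> borel_measurable borel" and mG: "G \<in> borel_measurable borel"
    using F G by (auto intro: borel_measurable_continuous_onI)
  have iF: "integrable lborel F"
  proof -
    obtain B where "\<And>x. \<bar>F x\<bar> \<le> B" using bounded_range_if_supported[OF K(1) F K(2)] by metis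
    from integrable_mult_supported[OF K(1) _ mF this K(2), of "\<lambda>x. 1"] show ?thesis by simp
  qed
  have ds: "((\<lambda>s. F (x + s *\<^sub>R v)) has_real_derivative G (x + r *\<^sub>R v)) (at r)" for x r
    using DERIV_shift[of "\<lambda>s. F (x + s *\<^sub>R v)" "G (x + r *\<^sub>R v)" 0 r] d[of "x + r *\<^sub>R v"]
    by (simp add: algebra_simps)
  define h where "h n = inverse (real (Suc n))" for n
  have h: "0 < h n" "h n \<le> 1" for n unfolding h_def by (auto simp: field_simps)
  define q where "q n x = (F (h n *\<^sub>R v + x) - F x) / h n" for n x
  have qb: "\<bar>q n x\<bar> \<le> L * indicator (cball 0 (\<rho> + norm v)) x" for n x
  proof (cases "x \<in> cball 0 (\<rho> + norm v)")
    case True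
    from MVT2[OF h(1)[of n] ds[of x]] obtain r where
      "F (x + h n *\<^sub>R v) - F (x + 0 *\<^sub>R v) = (h n - 0) * G (x + r *\<^sub>R v)" by blast
    then have "q n x = G (x + r *\<^sub>R v)" using h(1)[of n] by (simp add: q_def add.commute)
    with L True show ?thesis by simp
  next
    case False
    have "norm (h n *\<^sub>R v) \<le> norm v" using h[of n] by (simp add: mult_left_le_one_le)
    then have "norm x - norm v \<le> norm (h n *\<^sub>R v + x)"
      using norm_triangle_ineq4[of "h n *\<^sub>R v + x" "h n *\<^sub>R v"] by simp
    then have "h n *\<^sub>R v + x \<notin> K" "x \<notin> K" using False \<rho>[of x] \<rho>[of "h n *\<^sub>R v + x"]
      by (auto simp: not_le) (smt (verit) norm_ge_zero)+
    with K(2) False show ?thesis by (simp add: q_def)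
  qed
  have lim: "(\<lambda>n. integral\<^sup>L lborel (q n)) \<longlonglongrightarrow> integral\<^sup>L lborel G"
  proof (rule integral_dominated_convergence)
    show "integrable lborel (\<lambda>x::'a. L * indicator (cball 0 (\<rho> + norm v)) x)"
      by (intro integrable_mult_right integrable_real_indicator emeasure_compact_finite)
        (auto simp: emeasure_compact_finite)
    show "AE x in lborel. (\<lambda>n. q n x) \<longlonglongrightarrow> G x"
    proof (rule AE_I2)
      fix x
      have "((\<lambda>s. (F (x + s *\<^sub>R v) - F x) / s) \<longlongrightarrow> G x) (at 0)"
        using d[of x] by (simp add: DERIV_def)
      moreover have "filterlim h (at 0) sequentially"
        unfolding filterlim_at using LIMSEQ_inverse_real_of_nat h(1)
        by (auto simp: h_def[abs_def] less_imp_neq[symmetric])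
      ultimately show "(\<lambda>n. q n x) \<longlonglongrightarrow> G x"
        unfolding q_def by (subst add.commute) (rule filterlim_compose)
    qed
    show "q n \<in> borel_measurable lborel" for n unfolding q_def using mF by measurable
  qed (use qb mG in auto)
  have "integral\<^sup>L lborel (q n) = 0" for n
  proof -
    have "integrable lborel (\<lambda>x. F (h n *\<^sub>R v + x))"
    proof -
      have "integrable (distr lborel borel ((+) (h n *\<^sub>R v))) F" using iF by (simp add: lborel_distr_plus)
      then show ?thesis by (subst (asm) integrable_distr_eq) (use mF in auto)
    qed
    with iF have "integral\<^sup>L lborel (q n) = ((\<integral>x. F (h n *\<^sub>R v + x) \<partial>lborel) - integral\<^sup>L lborel F) / h n"
      unfolding q_def by simp
    with integral_lborel_translate[OF mF] show ?thesis by simp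
  qed
  with lim show ?thesis by (simp add: LIMSEQ_const_iff)
qed

lemma integration_by_parts_compact_support:
  fixes f f' g g' :: "'a::euclidean_space \<Rightarrow> real"
  assumes S: "open S" "compact K" "K \<subseteq> S"
    and f: "\<And>x. x \<in> S \<Longrightarrow> ((\<lambda>s. f (x + s *\<^sub>R v)) has_real_derivative f' x) (at 0)"
      "continuous_on S f" "continuous_on S f'"
    and g: "\<And>x. ((\<lambda>s. g (x + s *\<^sub>R v)) has_real_derivative g' x) (at 0)"
      "continuous_on UNIV g" "continuous_on UNIV g'"
      "\<And>x. x \<notin> K \<Longrightarrow> g x = 0" "\<And>x. x \<notin> K \<Longrightarrow> g' x = 0"
  shows "(\<integral>x. f' x * g x \<partial>lborel) = - (\<integral>x. f x * g' x \<partial>lborel)"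
proof -
  have cl: "closed K" using S(2) compact_imp_closed by blast
  have "(\<integral>x. f' x * g x + f x * g' x \<partial>lborel) = 0"
  proof (rule integral_directional_derivative_eq_0[where F = "\<lambda>x. f x * g x" and K = K])
    fix x
    show "((\<lambda>s. f (x + s *\<^sub>R v) * g (x + s *\<^sub>R v)) has_real_derivative f' x * g x + f x * g' x) (at 0)"
    proof (cases "x \<in> S")
      case True
      from DERIV_mult[OF f(1)[OF True] g(1)[of x]] show ?thesis by (simp add: mult.commute add.commute)
    next
      case False
      then have x: "x \<notin> K" using S by auto
      have "open ((\<lambda>s::real. x + s *\<^sub>R v) -` (- K))"
        using cl by (intro open_vimage continuous_intros) auto
      from eventually_nhds_in_open[OF this, of 0] x have "\<forall>\<^sub>F s in nhds 0. x + s *\<^sub>R v \<in> - K"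
        by simp
      then have "\<forall>\<^sub>F s in nhds 0. f (x + s *\<^sub>R v) * g (x + s *\<^sub>R v) = 0"
        by eventually_elim (use g(4) in auto)
      then have "((\<lambda>s. f (x + s *\<^sub>R v) * g (x + s *\<^sub>R v)) has_real_derivative 0) (at 0)
          \<longleftrightarrow> ((\<lambda>s::real. 0::real) has_real_derivative 0) (at 0)"
        by (intro DERIV_cong_ev) auto
      then show ?thesis using g(4,5)[OF x] by simp
    qed
  qed (use S g f cl in \<open>auto intro!: continuous_on_add continuous_on_mult_supported[of S K]\<close>)
  moreover have "integrable lborel (\<lambda>x. f' x * g x)" "integrable lborel (\<lambda>x. f x * g' x)"
  proof -
    obtain B where B: "\<And>x. \<bar>g x\<bar> \<le> B" using bounded_range_if_supported[OF S(2) g(2,4)] by metis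
    obtain B' where B': "\<And>x. \<bar>g' x\<bar> \<le> B'" using bounded_range_if_supported[OF S(2) g(3,5)] by metis
    show "integrable lborel (\<lambda>x. f' x * g x)" 
      by (rule integrable_mult_supported[OF S(2) _ _ B g(4)])
        (use S f g in \<open>auto intro: continuous_on_subset borel_measurable_continuous_onI\<close>)
    show "integrable lborel (\<lambda>x. f x * g' x)"
      by (rule integrable_mult_supported[OF S(2) _ _ B' g(5)])
        (use S f g in \<open>auto intro: continuous_on_subset borel_measurable_continuous_onI\<close>)
  qed
  ultimately show ?thesis by simp
qed

text \<open>Tonelli's theorem, applied to the indicator function of \<open>N\<close> at \<open>x + sv\<close> over all
  \<open>x\<close> and all \<open>s \<in> [0,1]\<close>: integrating over \<open>s\<close> first gives \<open>0\<close>, integrating over \<open>x\<close> first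
  gives the measure of \<open>N\<close>.\<close>

lemma null_set_if_countable_line_sections:
  fixes N :: "'a::euclidean_space set"
  assumes N: "N \<in> sets borel" and c: "\<And>x. countable {s::real. x + s *\<^sub>R v \<in> N}"
  shows "N \<in> null_sets lborel"
proof -
  let ?f = "\<lambda>(x::'a, s::real). indicator {0..1} s * (indicator N (s *\<^sub>R v + x) :: ennreal)"
  have m: "?f \<in> borel_measurable (lborel \<Otimes>\<^sub>M lborel)"
  proof -
    have "(\<lambda>z. snd z *\<^sub>R v + fst z) \<in> borel_measurable (lborel \<Otimes>\<^sub>M lborel)" by measurable
    from measurable_compose[OF this borel_measurable_indicator[OF N]]
    have "(\<lambda>z. indicator N (snd z *\<^sub>R v + fst z) :: ennreal) \<in> borel_measurable (lborel \<Otimes>\<^sub>M lborel)"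
      by (simp add: o_def)
    then show ?thesis by (simp add: split_beta) measurable
  qed
  have "(\<integral>\<^sup>+x. \<integral>\<^sup>+s. ?f (x, s) \<partial>lborel \<partial>lborel) = nn_integral lborel (\<lambda>x::'a. 0)"
  proof (rule nn_integral_cong)
    fix x :: 'a
    have "{s. x + s *\<^sub>R v \<in> N} \<in> null_sets lborel" using c countable_imp_null_set_lborel by blast
    then have "AE s in lborel. s \<notin> {s. x + s *\<^sub>R v \<in> N}" by (rule AE_not_in)
    then have "(\<integral>\<^sup>+s. ?f (x, s) \<partial>lborel) = nn_integral lborel (\<lambda>s::real. 0)"
      by (intro nn_integral_cong_AE) (auto simp: add.commute split: split_indicator elim!: eventually_mono)
    then show "(\<integral>\<^sup>+s. ?f (x, s) \<partial>lborel) = 0" by simp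
  qed
  then have "(\<integral>\<^sup>+s. \<integral>\<^sup>+x. ?f (x, s) \<partial>lborel \<partial>lborel) = 0"
    using lborel_pair.Fubini[OF m] by simp
  moreover have "(\<integral>\<^sup>+x. ?f (x, s) \<partial>lborel) = emeasure lborel N * indicator {0..1} s" for s
  proof -
    have "(\<integral>\<^sup>+x. indicator N (s *\<^sub>R v + x) \<partial>lborel) = (\<integral>\<^sup>+x. indicator N x \<partial>distr lborel borel ((+) (s *\<^sub>R v)))"
      using N by (subst nn_integral_distr) auto
    also have "\<dots> = emeasure lborel N" using N by (simp add: lborel_distr_plus)
    finally show ?thesis by (simp add: mult.commute split: split_indicator)
  qed
  ultimately have "emeasure lborel N = 0"
    by (simp add: nn_integral_cmult)
  with N show ?thesis by auto
qed

lemma countable_simple_zeros: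
  fixes g g' :: "real \<Rightarrow> real"
  assumes "\<And>s. (g has_real_derivative g' s) (at s)"
  shows "countable {s. g s = 0 \<and> g' s \<noteq> 0}" (is "countable ?N")
proof -
  obtain \<B> :: "real set set" where \<B>: "countable \<B>" "topological_basis \<B>"
    using ex_countable_basis by blast
  have "\<exists>b\<in>\<B>. s \<in> b \<and> b \<inter> ?N \<subseteq> {s}" if s: "s \<in> ?N" for s
  proof -
    have "((\<lambda>y. (g y - g s) / (y - s)) \<longlongrightarrow> g' s) (at s)"
      using assms[of s] by (simp add: has_field_derivative_iff)
    from tendsto_imp_eventually_ne[OF this, of 0] s have "\<forall>\<^sub>F y in at s. g y \<noteq> 0"
      by (auto elim!: eventually_mono)
    then obtain U where "open U" "s \<in> U" "\<And>y. y \<in> U \<Longrightarrow> y \<noteq> s \<Longrightarrow> g y \<noteq> 0"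
      by (auto simp: eventually_at_topological)
    moreover from topological_basisE[OF \<B>(2) this(1,2)] obtain b where "b \<in> \<B>" "s \<in> b" "b \<subseteq> U"
      by blast
    ultimately show ?thesis by (intro bexI[of _ b]) auto
  qed
  then have "\<forall>s\<in>?N. \<exists>b. b \<in> \<B> \<and> s \<in> b \<and> b \<inter> ?N \<subseteq> {s}" by blast
  from bchoice[OF this] obtain b where
    b: "\<And>s. s \<in> ?N \<Longrightarrow> b s \<in> \<B> \<and> s \<in> b s \<and> b s \<inter> ?N \<subseteq> {s}" by blast
  have "inj_on b ?N"
  proof (rule inj_onI)
    fix s r assume "s \<in> ?N" "r \<in> ?N" "b s = b r"
    with b[of s] b[of r] show "s = r" by blast
  qed
  moreover have "countable (b ` ?N)" using countable_subset[OF _ \<B>(1)] b by blast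
  ultimately show ?thesis using countable_image_inj_on by blast
qed

text \<open>The zeros of \<open>\<psi>\<close> are minima, hence zeros of the first derivative along every line. Those
  at which the second derivative does not vanish are simple zeros of the first
  derivative, so each line contains countably many of them.\<close>

lemma AE_second_derivative_zero_on_zeros:
  fixes \<psi> :: "'a::euclidean_space \<Rightarrow> real"
  assumes s: "smooth_on UNIV \<psi>" and nonneg: "\<And>x. 0 \<le> \<psi> x"
  shows "AE x in lborel. \<psi> x = 0 \<longrightarrow> dderiv v (dderiv v \<psi>) x = 0"
proof -
  let ?D = "dderiv v (dderiv v \<psi>)"
  let ?N = "{x. \<psi> x = 0 \<and> ?D x \<noteq> 0}"
  have m: "\<psi> \<in> borel_measurable borel" "?D \<in> borel_measurable borel"
    by (intro borel_measurable_continuous_onI smooth_on_continuous smooth_on_dderiv s)+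
  have "?N \<in> null_sets lborel"
  proof (rule null_set_if_countable_line_sections)
    show "?N \<in> sets borel" using m by measurable
    fix x
    let ?g = "\<lambda>s. dderiv v \<psi> (x + s *\<^sub>R v)"
    have "?g s = 0" if "\<psi> (x + s *\<^sub>R v) = 0" for s
      using has_real_derivative_along_line[OF smooth_on_differentiable[OF s UNIV_I]]
      by (rule DERIV_local_min[of _ _ _ 1]) (use that nonneg in auto)
    moreover have "(?g has_real_derivative ?D (x + s *\<^sub>R v)) (at s)" for s
      by (rule has_real_derivative_along_line[OF smooth_on_differentiable[OF smooth_on_dderiv[OF s] UNIV_I]])
    from countable_simple_zeros[OF this]
    have "countable {s. ?g s = 0 \<and> ?D (x + s *\<^sub>R v) \<noteq> 0}" .
    ultimately show "countable {s. x + s *\<^sub>R v \<in> ?N}" 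
      by (auto elim: countable_subset[rotated])
  qed
  then have "AE x in lborel. x \<notin> ?N" by (rule AE_not_in)
  then show ?thesis by (auto elim: eventually_mono)
qed

lemma iterated_set_integral_eq_integral:
  fixes G :: "'a::euclidean_space \<times> 'b::euclidean_space \<Rightarrow> real"
  assumes G: "integrable lborel G" "\<And>t x. t \<notin> A \<or> x \<notin> B \<Longrightarrow> G (t, x) = 0"
    and f: "\<And>t x. t \<in> A \<Longrightarrow> x \<in> B \<Longrightarrow> f t x = G (t, x)"
  shows "(LINT t:A|lborel. LINT x:B|lborel. f t x) = integral\<^sup>L lborel G"
    and "set_integrable lborel A (\<lambda>t. LINT x:B|lborel. f t x)"
proof -
  have eq: "indicator A t *\<^sub>R (LINT x:B|lborel. f t x) = (\<integral>x. G (t, x) \<partial>lborel)" for t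
  proof (cases "t \<in> A")
    case True
    then have "indicator B x *\<^sub>R f t x = G (t, x)" for x
      using f G(2) by (auto split: split_indicator)
    with True show ?thesis by (simp add: set_lebesgue_integral_def)
  next
    case False
    with G(2) show ?thesis by simp
  qed
  have G': "integrable (lborel \<Otimes>\<^sub>M lborel) G" using G(1) by (simp add: lborel_prod)
  show "(LINT t:A|lborel. LINT x:B|lborel. f t x) = integral\<^sup>L lborel G"
    using lborel_pair.integral_fst'[OF G'] unfolding set_lebesgue_integral_def[of lborel A] eq
    by (simp add: lborel_prod)
  show "set_integrable lborel A (\<lambda>t. LINT x:B|lborel. f t x)"
    using lborel_pair.integrable_fst'[OF G'] unfolding set_integrable_def eq .
qed

section \<open>The vorticity equation and the local enstrophy balance\<close>

lemma smooth_on_line_derivative: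
  fixes f :: "'a::euclidean_space \<Rightarrow> real"
  assumes "smooth_on S f" "x \<in> S"
  shows "((\<lambda>s. f (x + s *\<^sub>R v)) has_real_derivative dderiv v f x) (at 0)"
  using has_real_derivative_along_line[of f x 0 v] smooth_on_differentiable[OF assms] by simp

lemma line_derivative_of_zero:
  fixes f :: "'a::euclidean_space \<Rightarrow> real"
  assumes "open S" "x \<in> S" "\<And>y. y \<in> S \<Longrightarrow> f y = 0"
    and d: "((\<lambda>s. f (x + s *\<^sub>R v)) has_real_derivative d) (at 0)"
  shows "d = 0"
proof -
  have "open ((\<lambda>s::real. x + s *\<^sub>R v) -` S)"
    using assms(1) by (intro open_vimage continuous_intros) auto
  from eventually_nhds_in_open[OF this, of 0] assms(2)
  have "\<forall>\<^sub>F s in nhds 0. f (x + s *\<^sub>R v) = 0"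
    by (auto simp: assms(3) elim!: eventually_mono)
  then have "((\<lambda>s. f (x + s *\<^sub>R v)) has_real_derivative d) (at 0)
      \<longleftrightarrow> ((\<lambda>s::real. 0::real) has_real_derivative d) (at 0)"
    by (intro DERIV_cong_ev) auto
  with d show ?thesis using DERIV_unique[OF _ DERIV_const[of 0]] by blast
qed

text \<open>Taking the curl of the momentum equation: the pressure disappears by the symmetry of second
  derivatives, and the products of first derivatives add up to \<open>(\<partial>\<^sub>1 f1 + \<partial>\<^sub>2 f2) W\<close>, a multiple of the
  divergence, because the flow is planar.\<close>

lemma curl_of_momentum_equation:
  fixes f1 f2 P :: "'a::euclidean_space \<Rightarrow> real" and e0 e1 e2 :: 'a
  defines "W \<equiv> \<lambda>z. dderiv e1 f2 z - dderiv e2 f1 z"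
  assumes S: "open S" and sm: "smooth_on S f1" "smooth_on S f2" "smooth_on S P"
    and m1: "\<And>z. z \<in> S \<Longrightarrow> dderiv e0 f1 z - \<nu> * (dderiv e1 (dderiv e1 f1) z + dderiv e2 (dderiv e2 f1) z)
      + (f1 z * dderiv e1 f1 z + f2 z * dderiv e2 f1 z) + dderiv e1 P z = 0"
    and m2: "\<And>z. z \<in> S \<Longrightarrow> dderiv e0 f2 z - \<nu> * (dderiv e1 (dderiv e1 f2) z + dderiv e2 (dderiv e2 f2) z)
      + (f1 z * dderiv e1 f2 z + f2 z * dderiv e2 f2 z) + dderiv e2 P z = 0"
    and incompressible: "\<And>z. z \<in> S \<Longrightarrow> dderiv e1 f1 z + dderiv e2 f2 z = 0"
    and z: "z \<in> S"
  shows "dderiv e0 W z - \<nu> * (dderiv e1 (dderiv e1 W) z + dderiv e2 (dderiv e2 W) z)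
      + (f1 z * dderiv e1 W z + f2 z * dderiv e2 W z) = 0"
proof -
  note line = smooth_on_line_derivative[OF _ z]
  note sd = smooth_on_dderiv
  have q1: "dderiv e2 (dderiv e0 f1) z
      - \<nu> * (dderiv e2 (dderiv e1 (dderiv e1 f1)) z + dderiv e2 (dderiv e2 (dderiv e2 f1)) z)
      + ((dderiv e2 f1 z * dderiv e1 f1 z + f1 z * dderiv e2 (dderiv e1 f1) z)
        + (dderiv e2 f2 z * dderiv e2 f1 z + f2 z * dderiv e2 (dderiv e2 f1) z))
      + dderiv e2 (dderiv e1 P) z = 0"
    by (rule line_derivative_of_zero[OF S z m1], assumption)
      (use line[of _ e2, OF sm(1)] line[of _ e2, OF sm(2)] line[of _ e2, OF sd[OF sm(1)]]
         line[of _ e2, OF sd[OF sd[OF sm(1)]]] line[of _ e2, OF sd[OF sm(3)]]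
       in \<open>auto intro!: derivative_eq_intros\<close>)
  have q2: "dderiv e1 (dderiv e0 f2) z
      - \<nu> * (dderiv e1 (dderiv e1 (dderiv e1 f2)) z + dderiv e1 (dderiv e2 (dderiv e2 f2)) z)
      + ((dderiv e1 f1 z * dderiv e1 f2 z + f1 z * dderiv e1 (dderiv e1 f2) z)
        + (dderiv e1 f2 z * dderiv e2 f2 z + f2 z * dderiv e1 (dderiv e2 f2) z))
      + dderiv e1 (dderiv e2 P) z = 0"
    by (rule line_derivative_of_zero[OF S z m2], assumption)
      (use line[of _ e1, OF sm(1)] line[of _ e1, OF sm(2)] line[of _ e1, OF sd[OF sm(2)]]
         line[of _ e1, OF sd[OF sd[OF sm(2)]]] line[of _ e1, OF sd[OF sm(3)]]
       in \<open>auto intro!: derivative_eq_intros\<close>)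
  have swap: "dderiv v (dderiv w f) z = dderiv w (dderiv v f) z" if "smooth_on S f" for v w and f :: "'a \<Rightarrow> real"
    using Clairaut[OF S that z] .
  have swap2: "dderiv v (dderiv w (dderiv w f)) z = dderiv w (dderiv w (dderiv v f)) z"
    if "smooth_on S f" for v w and f :: "'a \<Rightarrow> real"
  proof -
    have "dderiv v (dderiv w (dderiv w f)) z = dderiv w (dderiv v (dderiv w f)) z"
      by (rule swap[OF sd[OF that]])
    also have "\<dots> = dderiv w (dderiv w (dderiv v f)) z"
      by (rule dderiv_cong_open[OF S z Clairaut[OF S that]])
    finally show ?thesis .
  qed
  have W1: "dderiv v W y = dderiv v (dderiv e1 f2) y - dderiv v (dderiv e2 f1) y" if "y \<in> S" for v y
    unfolding W_def by (rule dderiv_diff[OF smooth_on_differentiable[OF sd[OF sm(2)] that]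
          smooth_on_differentiable[OF sd[OF sm(1)] that]])
  have W2: "dderiv v (dderiv v W) z
      = dderiv v (dderiv v (dderiv e1 f2)) z - dderiv v (dderiv v (dderiv e2 f1)) z" for v
    by (rule trans[OF dderiv_cong_open[OF S z W1]
          dderiv_diff[OF smooth_on_differentiable[OF sd[OF sd[OF sm(2)]] z]
            smooth_on_differentiable[OF sd[OF sd[OF sm(1)]] z]]])
  have d: "dderiv e2 f2 z = - dderiv e1 f1 z" using incompressible[OF z] by linarith
  show ?thesis
    unfolding W1[OF z] W2
    using q1 q2 unfolding swap2[OF sm(1), where v=e2 and w=e1] swap2[OF sm(2), where v=e1 and w=e2]
      swap[OF sm(1), where v=e2 and w=e0] swap[OF sm(2), where v=e1 and w=e0] swap[OF sm(3), where v=e2 and w=e1]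
      swap[OF sm(2), where v=e1 and w=e2] swap[OF sm(1), where v=e2 and w=e1] d
    by (simp add: algebra_simps)
qed

text \<open>The vorticity equation is tested with \<open>W \<phi>\<close>. The terms \<open>\<partial>\<^sub>0 (W\<^sup>2/2) \<phi>\<close> and
  \<open>div (W\<^sup>2/2 f) \<phi>\<close> are integrated by parts once and \<open>W \<Delta>W \<phi> = div (W \<nabla>W) \<phi> - |\<nabla>W|\<^sup>2 \<phi>\<close>
  twice.\<close>

lemma enstrophy_balance:
  fixes W f1 f2 \<phi> \<phi>0 \<phi>1 \<phi>2 \<phi>11 \<phi>22 :: "'a::euclidean_space \<Rightarrow> real" and e0 e1 e2 :: 'a
  assumes S: "open S" "compact K" "K \<subseteq> S"
    and sm: "smooth_on S W" "smooth_on S f1" "smooth_on S f2"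
    and transport: "\<And>z. z \<in> S \<Longrightarrow>
      dderiv e0 W z - \<nu> * (dderiv e1 (dderiv e1 W) z + dderiv e2 (dderiv e2 W) z)
      + (f1 z * dderiv e1 W z + f2 z * dderiv e2 W z) = 0"
    and incompressible: "\<And>z. z \<in> S \<Longrightarrow> dderiv e1 f1 z + dderiv e2 f2 z = 0"
    and d\<phi>: "\<And>z. ((\<lambda>s. \<phi> (z + s *\<^sub>R e0)) has_real_derivative \<phi>0 z) (at 0)"
      "\<And>z. ((\<lambda>s. \<phi> (z + s *\<^sub>R e1)) has_real_derivative \<phi>1 z) (at 0)"
      "\<And>z. ((\<lambda>s. \<phi> (z + s *\<^sub>R e2)) has_real_derivative \<phi>2 z) (at 0)"
      "\<And>z. ((\<lambda>s. \<phi>1 (z + s *\<^sub>R e1)) has_real_derivative \<phi>11 z) (at 0)"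
      "\<And>z. ((\<lambda>s. \<phi>2 (z + s *\<^sub>R e2)) has_real_derivative \<phi>22 z) (at 0)"
    and c\<phi>: "\<And>f. f \<in> {\<phi>, \<phi>0, \<phi>1, \<phi>2, \<phi>11, \<phi>22} \<Longrightarrow> continuous_on UNIV f"
    and s\<phi>: "\<And>f z. f \<in> {\<phi>, \<phi>0, \<phi>1, \<phi>2, \<phi>11, \<phi>22} \<Longrightarrow> z \<notin> K \<Longrightarrow> f z = 0"
  shows "(\<integral>z. 1 / 2 * (W z)\<^sup>2 * (f1 z * \<phi>1 z + f2 z * \<phi>2 z) \<partial>lborel)
    = \<nu> * (\<integral>z. ((dderiv e1 W z)\<^sup>2 + (dderiv e2 W z)\<^sup>2) * \<phi> z \<partial>lborel)
      - (\<integral>z. 1 / 2 * (W z)\<^sup>2 * (\<phi>0 z + \<nu> * (\<phi>11 z + \<phi>22 z)) \<partial>lborel)"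
proof -
  have cont: "continuous_on S W" "continuous_on S f1" "continuous_on S f2"
      "continuous_on S (dderiv v W)" "continuous_on S (dderiv v (dderiv v W))"
      "continuous_on S (dderiv v f1)" "continuous_on S (dderiv v f2)" for v
    by (intro smooth_on_continuous smooth_on_dderiv sm)+
  have int: "integrable lborel (\<lambda>z. f z * g z)"
    if f: "continuous_on S f" and g: "g \<in> {\<phi>, \<phi>0, \<phi>1, \<phi>2, \<phi>11, \<phi>22}" for f g
  proof -
    obtain B where B: "\<And>x. \<bar>g x\<bar> \<le> B"
      using bounded_range_if_supported[OF S(2) c\<phi>[OF g] s\<phi>[OF g]] by metis
    show ?thesis
      by (rule integrable_mult_supported[OF S(2) continuous_on_subset[OF f S(3)]
            borel_measurable_continuous_onI[OF c\<phi>[OF g]] B s\<phi>[OF g]])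
  qed
  have by_parts: "(\<integral>z. f' z * g z \<partial>lborel) = - (\<integral>z. f z * g' z \<partial>lborel)"
    if "\<And>z. z \<in> S \<Longrightarrow> ((\<lambda>s. f (z + s *\<^sub>R v)) has_real_derivative f' z) (at 0)"
      "continuous_on S f" "continuous_on S f'"
      "\<And>z. ((\<lambda>s. g (z + s *\<^sub>R v)) has_real_derivative g' z) (at 0)"
      "g \<in> {\<phi>, \<phi>0, \<phi>1, \<phi>2, \<phi>11, \<phi>22}" "g' \<in> {\<phi>, \<phi>0, \<phi>1, \<phi>2, \<phi>11, \<phi>22}" for f f' g g' v
    using integration_by_parts_compact_support[OF S that(1,2,3,4) c\<phi>[OF that(5)] c\<phi>[OF that(6)]
        s\<phi>[OF that(5)] s\<phi>[OF that(6)]] by blast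
  note line = smooth_on_line_derivative
  have dE: "((\<lambda>s. 1 / 2 * (W (z + s *\<^sub>R v))\<^sup>2) has_real_derivative W z * dderiv v W z) (at 0)"
    if "z \<in> S" for z v
    using line[OF sm(1) that, of v] by (auto intro!: derivative_eq_intros)
  have time: "(\<integral>z. (W z * dderiv e0 W z) * \<phi> z \<partial>lborel) = - (\<integral>z. 1 / 2 * (W z)\<^sup>2 * \<phi>0 z \<partial>lborel)"
    by (rule by_parts[OF dE _ _ d\<phi>(1)]) (auto intro!: continuous_intros cont)
  have adv: "(\<integral>z. (W z * dderiv v W z * f z + 1 / 2 * (W z)\<^sup>2 * dderiv v f z) * \<phi> z \<partial>lborel)
      = - (\<integral>z. 1 / 2 * (W z)\<^sup>2 * f z * \<phi>' z \<partial>lborel)"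
    if "smooth_on S f" "\<And>z. ((\<lambda>s. \<phi> (z + s *\<^sub>R v)) has_real_derivative \<phi>' z) (at 0)"
      "\<phi>' \<in> {\<phi>, \<phi>0, \<phi>1, \<phi>2, \<phi>11, \<phi>22}" for f v \<phi>'
  proof (rule by_parts[OF _ _ _ that(2) _ that(3)])
    show "((\<lambda>s. 1 / 2 * (W (z + s *\<^sub>R v))\<^sup>2 * f (z + s *\<^sub>R v)) has_real_derivative
        W z * dderiv v W z * f z + 1 / 2 * (W z)\<^sup>2 * dderiv v f z) (at 0)" if "z \<in> S" for z
      using DERIV_mult[OF dE[OF that, of v] line[OF \<open>smooth_on S f\<close> that, of v]]
      by (simp add: mult_ac add_ac)
  qed (use smooth_on_continuous[OF that(1)] smooth_on_continuous[OF smooth_on_dderiv[OF that(1)]]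
       in \<open>auto intro!: continuous_intros cont\<close>)
  have visc: "(\<integral>z. ((dderiv v W z)\<^sup>2 + W z * dderiv v (dderiv v W) z) * \<phi> z \<partial>lborel)
      = (\<integral>z. 1 / 2 * (W z)\<^sup>2 * \<phi>'' z \<partial>lborel)"
    if "\<And>z. ((\<lambda>s. \<phi> (z + s *\<^sub>R v)) has_real_derivative \<phi>' z) (at 0)"
      "\<And>z. ((\<lambda>s. \<phi>' (z + s *\<^sub>R v)) has_real_derivative \<phi>'' z) (at 0)"
      "\<phi>' \<in> {\<phi>, \<phi>0, \<phi>1, \<phi>2, \<phi>11, \<phi>22}" "\<phi>'' \<in> {\<phi>, \<phi>0, \<phi>1, \<phi>2, \<phi>11, \<phi>22}" for v \<phi>' \<phi>''
  proof -
    have "(\<integral>z. ((dderiv v W z)\<^sup>2 + W z * dderiv v (dderiv v W) z) * \<phi> z \<partial>lborel)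
        = - (\<integral>z. (W z * dderiv v W z) * \<phi>' z \<partial>lborel)"
    proof (rule by_parts[OF _ _ _ that(1) _ that(3)])
      show "((\<lambda>s. W (z + s *\<^sub>R v) * dderiv v W (z + s *\<^sub>R v)) has_real_derivative
          (dderiv v W z)\<^sup>2 + W z * dderiv v (dderiv v W) z) (at 0)" if "z \<in> S" for z
        using DERIV_mult[OF line[OF sm(1) that, of v] line[OF smooth_on_dderiv[OF sm(1)] that, of v]]
        by (simp add: power2_eq_square mult_ac add_ac)
    qed (auto intro!: continuous_intros cont)
    also have "(\<integral>z. (W z * dderiv v W z) * \<phi>' z \<partial>lborel) = - (\<integral>z. 1 / 2 * (W z)\<^sup>2 * \<phi>'' z \<partial>lborel)"
      by (rule by_parts[OF dE _ _ that(2,3,4)]) (auto intro!: continuous_intros cont)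
    finally show ?thesis by simp
  qed
  have mem: "\<phi>1 \<in> {\<phi>, \<phi>0, \<phi>1, \<phi>2, \<phi>11, \<phi>22}" "\<phi>2 \<in> {\<phi>, \<phi>0, \<phi>1, \<phi>2, \<phi>11, \<phi>22}"
    "\<phi>11 \<in> {\<phi>, \<phi>0, \<phi>1, \<phi>2, \<phi>11, \<phi>22}" "\<phi>22 \<in> {\<phi>, \<phi>0, \<phi>1, \<phi>2, \<phi>11, \<phi>22}"
    by auto
  note a1 = adv[OF sm(2) d\<phi>(2) mem(1)] and a2 = adv[OF sm(3) d\<phi>(3) mem(2)]
    and v1 = visc[OF d\<phi>(2,4) mem(1,3)] and v2 = visc[OF d\<phi>(3,5) mem(2,4)]
  let ?T = "\<lambda>z. (W z * dderiv e0 W z) * \<phi> z"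
  let ?A1 = "\<lambda>z. (W z * dderiv e1 W z * f1 z + 1 / 2 * (W z)\<^sup>2 * dderiv e1 f1 z) * \<phi> z"
  let ?A2 = "\<lambda>z. (W z * dderiv e2 W z * f2 z + 1 / 2 * (W z)\<^sup>2 * dderiv e2 f2 z) * \<phi> z"
  let ?V1 = "\<lambda>z. ((dderiv e1 W z)\<^sup>2 + W z * dderiv e1 (dderiv e1 W) z) * \<phi> z"
  let ?V2 = "\<lambda>z. ((dderiv e2 W z)\<^sup>2 + W z * dderiv e2 (dderiv e2 W) z) * \<phi> z"
  let ?P = "\<lambda>z. ((dderiv e1 W z)\<^sup>2 + (dderiv e2 W z)\<^sup>2) * \<phi> z"
  have i: "integrable lborel ?T" "integrable lborel ?A1" "integrable lborel ?A2"
    "integrable lborel ?V1" "integrable lborel ?V2" "integrable lborel ?P"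
    by (intro int continuous_intros cont; simp)+
  have pointwise: "?T z + (?A1 z + ?A2 z) - \<nu> * (?V1 z + ?V2 z) + \<nu> * ?P z = 0" for z
  proof (cases "z \<in> S")
    case True
    have "?T z + (?A1 z + ?A2 z) - \<nu> * (?V1 z + ?V2 z) + \<nu> * ?P z
      = (dderiv e0 W z - \<nu> * (dderiv e1 (dderiv e1 W) z + dderiv e2 (dderiv e2 W) z)
          + (f1 z * dderiv e1 W z + f2 z * dderiv e2 W z)) * (W z * \<phi> z)
        + (dderiv e1 f1 z + dderiv e2 f2 z) * (1 / 2 * (W z)\<^sup>2 * \<phi> z)"
      by (simp add: algebra_simps)
    then show ?thesis using transport[OF True] incompressible[OF True] by simp
  next
    case False
    with S(3) have "\<phi> z = 0" using s\<phi>[of \<phi>] by auto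
    then show ?thesis by simp
  qed
  have "0 = (\<integral>z. ?T z + (?A1 z + ?A2 z) - \<nu> * (?V1 z + ?V2 z) + \<nu> * ?P z \<partial>lborel)"
    unfolding pointwise by simp
  also have "\<dots> = integral\<^sup>L lborel ?T + (integral\<^sup>L lborel ?A1 + integral\<^sup>L lborel ?A2)
      - \<nu> * (integral\<^sup>L lborel ?V1 + integral\<^sup>L lborel ?V2) + \<nu> * integral\<^sup>L lborel ?P"
    by (simp only: i Bochner_Integration.integral_add Bochner_Integration.integral_diff
      Bochner_Integration.integrable_add Bochner_Integration.integrable_diff
      integrable_mult_right integral_mult_right_zero)
  finally have main: "0 = \<dots>" .
  have j: "integrable lborel (\<lambda>z. 1 / 2 * (W z)\<^sup>2 * g z)" if "g \<in> {\<phi>, \<phi>0, \<phi>1, \<phi>2, \<phi>11, \<phi>22}" for g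
    by (rule int[OF _ that]) (intro continuous_intros cont)
  have j': "integrable lborel (\<lambda>z. 1 / 2 * (W z)\<^sup>2 * f1 z * \<phi>1 z)"
    "integrable lborel (\<lambda>z. 1 / 2 * (W z)\<^sup>2 * f2 z * \<phi>2 z)"
    by (intro int continuous_intros cont; simp)+
  have lhs: "(\<integral>z. 1 / 2 * (W z)\<^sup>2 * (f1 z * \<phi>1 z + f2 z * \<phi>2 z) \<partial>lborel)
      = (\<integral>z. 1 / 2 * (W z)\<^sup>2 * f1 z * \<phi>1 z \<partial>lborel) + (\<integral>z. 1 / 2 * (W z)\<^sup>2 * f2 z * \<phi>2 z \<partial>lborel)"
    using Bochner_Integration.integral_add[OF j'] by (simp add: algebra_simps)
  have rhs: "(\<integral>z. 1 / 2 * (W z)\<^sup>2 * (\<phi>0 z + \<nu> * (\<phi>11 z + \<phi>22 z)) \<partial>lborel)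
      = (\<integral>z. 1 / 2 * (W z)\<^sup>2 * \<phi>0 z \<partial>lborel)
        + \<nu> * ((\<integral>z. 1 / 2 * (W z)\<^sup>2 * \<phi>11 z \<partial>lborel) + (\<integral>z. 1 / 2 * (W z)\<^sup>2 * \<phi>22 z \<partial>lborel))"
  proof -
    have "(\<integral>z. 1 / 2 * (W z)\<^sup>2 * (\<phi>0 z + \<nu> * (\<phi>11 z + \<phi>22 z)) \<partial>lborel)
      = (\<integral>z. 1 / 2 * (W z)\<^sup>2 * \<phi>0 z
          + \<nu> * (1 / 2 * (W z)\<^sup>2 * \<phi>11 z + 1 / 2 * (W z)\<^sup>2 * \<phi>22 z) \<partial>lborel)"
      by (rule arg_cong[of _ _ "integral\<^sup>L lborel"]) (auto simp: algebra_simps)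
    also have "\<dots> = (\<integral>z. 1 / 2 * (W z)\<^sup>2 * \<phi>0 z \<partial>lborel)
        + \<nu> * ((\<integral>z. 1 / 2 * (W z)\<^sup>2 * \<phi>11 z \<partial>lborel) + (\<integral>z. 1 / 2 * (W z)\<^sup>2 * \<phi>22 z \<partial>lborel))"
      by (simp only: j[of \<phi>0] j[of \<phi>11] j[of \<phi>22] insert_iff simp_thms Bochner_Integration.integral_add
        Bochner_Integration.integrable_add integrable_mult_right integral_mult_right_zero)
    finally show ?thesis .
  qed
  show ?thesis
    using main unfolding lhs rhs time a1 a2 v1 v2 by linarith
qed

section \<open>Planar Navier--Stokes flows on space-time\<close>

abbreviation tdir :: "real \<times> plane" where "tdir \<equiv> (1, 0)"
abbreviation sdir :: "2 \<Rightarrow> real \<times> plane" where "sdir j \<equiv> (0, axis j 1)"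

abbreviation vorticity :: "(real \<Rightarrow> plane \<Rightarrow> plane) \<Rightarrow> real \<times> plane \<Rightarrow> real" where
  "vorticity u \<equiv> (\<lambda>z. curl (u (fst z)) (snd z))"

lemma time_slice_derivative:
  assumes "F differentiable at (t, x)"
  shows "vector_derivative (\<lambda>s. F (s, x)) (at t) = dderiv (1, 0) F (t, x)"
proof -
  have "((\<lambda>s. (s, x)) has_derivative (\<lambda>s. (s, 0))) (at t)" by (auto intro!: derivative_eq_intros)
  from diff_chain_at[OF this has_derivative_frechet[OF assms]]
  have "((\<lambda>s. F (s, x)) has_derivative (\<lambda>s. dderiv (s, 0) F (t, x))) (at t)" by (simp add: o_def)
  moreover have "dderiv (s, 0) F (t, x) = s *\<^sub>R dderiv (1, 0) F (t, x)" for s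
    using linear_scale[OF linear_frechet_derivative[OF assms], of s "(1, 0)"]
    by (simp only: scaleR_Pair scaleR_zero_right real_scaleR_def mult_1_right)
  ultimately have "((\<lambda>s. F (s, x)) has_vector_derivative dderiv (1, 0) F (t, x)) (at t)"
    unfolding has_vector_derivative_def by (rule has_derivative_eq_rhs[OF _ ext])
  then show ?thesis by (rule vector_derivative_at)
qed

lemma partial_slice:
  assumes "F differentiable at (t, x)"
  shows "partial j (\<lambda>y. F (t, y)) x = dderiv (sdir j) F (t, x)"
proof -
  have "((\<lambda>y. (t, y)) has_derivative (\<lambda>v. (0, v))) (at x)" by (auto intro!: derivative_eq_intros)
  from diff_chain_at[OF this has_derivative_frechet[OF assms]]
  have "((\<lambda>y. F (t, y)) has_derivative (\<lambda>v. dderiv (0, v) F (t, x))) (at x)" by (simp add: o_def)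
  from fun_cong[OF frechet_derivative_at[OF this]] show ?thesis by (simp add: partial_def)
qed

lemma partial_cong_open:
  assumes "open S" "x \<in> S" "\<And>y. y \<in> S \<Longrightarrow> f y = g y"
  shows "partial j f x = partial j g x"
  unfolding partial_def using dderiv_cong_open[OF assms] .

lemma second_partial_slice:
  assumes "open S" "smooth_on S F" "(t, x) \<in> S"
  shows "partial j (partial k (\<lambda>y. F (t, y))) x = dderiv (sdir j) (dderiv (sdir k) F) (t, x)"
proof -
  have "open (Pair t -` S)" by (intro open_vimage assms continuous_intros)
  then have "partial j (partial k (\<lambda>y. F (t, y))) x = partial j (\<lambda>y. dderiv (sdir k) F (t, y)) x"
    using assms(3) by (intro partial_cong_open[of "Pair t -` S"])
      (auto intro!: partial_slice smooth_on_differentiable[OF assms(2)])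
  also have "\<dots> = dderiv (sdir j) (dderiv (sdir k) F) (t, x)"
    by (rule partial_slice[OF smooth_on_differentiable[OF smooth_on_dderiv[OF assms(2)] assms(3)]])
  finally show ?thesis .
qed

text \<open>On the open set \<open>{0<..} \<times> \<Omega>\<close> of space-time the time derivative and the spatial partial
  derivatives are directional derivatives of one smooth function, so that all of them commute
  and the curl of the momentum equation can be taken there.\<close>

lemma NS_vorticity:
  assumes NS: "NS_solution \<nu> \<Omega> u p" and \<Omega>: "open \<Omega>"
  defines "S \<equiv> {0<..} \<times> \<Omega>" and "U \<equiv> \<lambda>k z. u (fst z) (snd z) $ k"
  shows "open S" and "smooth_on S (U k)" and "smooth_on S (vorticity u)"
    and "z \<in> S \<Longrightarrow> dderiv (sdir 1) (U 1) z + dderiv (sdir 2) (U 2) z = 0"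
    and "z \<in> S \<Longrightarrow> dderiv tdir (vorticity u) z
      - \<nu> * (dderiv (sdir 1) (dderiv (sdir 1) (vorticity u)) z
             + dderiv (sdir 2) (dderiv (sdir 2) (vorticity u)) z)
      + (U 1 z * dderiv (sdir 1) (vorticity u) z + U 2 z * dderiv (sdir 2) (vorticity u) z) = 0"
proof -
  let ?V = "\<lambda>z. u (fst z) (snd z)" and ?P = "\<lambda>z. p (fst z) (snd z)"
  show S: "open S" unfolding S_def by (intro open_Times \<Omega>) auto
  have V: "smooth_on S ?V" and P: "smooth_on S ?P"
    using NS unfolding NS_solution_def S_def by (simp_all add: case_prod_beta')
  have L: "bounded_linear (\<lambda>v::plane. v $ k)" for k by (rule bounded_linear_vec_nth)
  show U: "smooth_on S (U k)" for k
    unfolding U_def by (rule smooth_on_bounded_linear[OF S L V])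
  have dV: "?V differentiable at z" "dderiv v ?V differentiable at z" if "z \<in> S" for z v
    using smooth_on_differentiable[OF V that] smooth_on_differentiable[OF smooth_on_dderiv[OF V] that] by auto
  have c1: "dderiv v (U k) z = dderiv v ?V z $ k" if "z \<in> S" for v k z
    unfolding U_def by (rule dderiv_bounded_linear[OF L dV(1)[OF that]])
  have c2: "dderiv w (dderiv v (U k)) z = dderiv w (dderiv v ?V) z $ k" if "z \<in> S" for v w k z
    by (rule trans[OF dderiv_cong_open[OF S that c1] dderiv_bounded_linear[OF L dV(2)[OF that]]])
  have pU: "partial j (\<lambda>y. u t y $ k) x = dderiv (sdir j) (U k) (t, x)" if "(t, x) \<in> S" for j k t x
    using partial_slice[OF smooth_on_differentiable[OF U that]] by (simp add: U_def)
  let ?W = "\<lambda>z. dderiv (sdir 1) (U 2) z - dderiv (sdir 2) (U 1) z"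
  have W: "vorticity u z = ?W z" if "z \<in> S" for z
    using that by (cases z) (simp add: curl_def pU)
  have "smooth_on S ?W" by (intro smooth_on_diff S smooth_on_dderiv U)
  then show "smooth_on S (vorticity u)" using smooth_on_cong_open[of S "vorticity u" ?W] S W by blast
  have div: "dderiv (sdir 1) (U 1) z + dderiv (sdir 2) (U 2) z = 0" if "z \<in> S" for z
  proof -
    obtain t x where z: "z = (t, x)" by (cases z)
    with that NS have "divergence (u t) x = 0" by (auto simp: NS_solution_def S_def)
    with that show ?thesis unfolding z by (simp add: divergence_def sum_2 pU)
  qed
  then show "z \<in> S \<Longrightarrow> dderiv (sdir 1) (U 1) z + dderiv (sdir 2) (U 2) z = 0" .
  have momentum: "dderiv tdir (U k) z
      - \<nu> * (dderiv (sdir 1) (dderiv (sdir 1) (U k)) z + dderiv (sdir 2) (dderiv (sdir 2) (U k)) z)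
      + (U 1 z * dderiv (sdir 1) (U k) z + U 2 z * dderiv (sdir 2) (U k) z)
      + dderiv (sdir k) ?P z = 0" if "z \<in> S" for z k
  proof -
    obtain t x where z: "z = (t, x)" by (cases z)
    have "vector_derivative (\<lambda>s. u s x) (at t) - \<nu> *\<^sub>R laplacian (u t) x
          + (\<Sum>j\<in>UNIV. (u t x $ j) *\<^sub>R partial j (u t) x) + grad (p t) x = 0"
      using that NS unfolding z by (auto simp: NS_solution_def S_def)
    then have "(vector_derivative (\<lambda>s. u s x) (at t) - \<nu> *\<^sub>R laplacian (u t) x
          + (\<Sum>j\<in>UNIV. (u t x $ j) *\<^sub>R partial j (u t) x) + grad (p t) x) $ k = 0" by simp
    moreover have "vector_derivative (\<lambda>s. u s x) (at t) = dderiv tdir ?V (t, x)"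
      using time_slice_derivative[OF dV(1)[OF that[unfolded z]]] by simp
    moreover have "partial j (u t) x = dderiv (sdir j) ?V (t, x)" for j
      using partial_slice[OF dV(1)[OF that[unfolded z]]] by simp
    moreover have "partial j (partial j (u t)) x = dderiv (sdir j) (dderiv (sdir j) ?V) (t, x)" for j
      using second_partial_slice[OF S V that[unfolded z]] by simp
    moreover have "partial k (p t) x = dderiv (sdir k) ?P (t, x)"
      using partial_slice[OF smooth_on_differentiable[OF P that[unfolded z]]] by simp
    ultimately show ?thesis
      unfolding c1[OF that] c2[OF that] unfolding z
      by (simp add: laplacian_def sum_2 grad_def U_def)
  qed
  assume z: "z \<in> S"
  have "dderiv tdir ?W z - \<nu> * (dderiv (sdir 1) (dderiv (sdir 1) ?W) z
             + dderiv (sdir 2) (dderiv (sdir 2) ?W) z)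
      + (U 1 z * dderiv (sdir 1) ?W z + U 2 z * dderiv (sdir 2) ?W z) = 0"
    by (rule curl_of_momentum_equation[OF S U U P momentum momentum div z])
  moreover have W1: "dderiv v (vorticity u) y = dderiv v ?W y" if "y \<in> S" for v y
    by (rule dderiv_cong_open[OF S that]) (rule W)
  moreover have "dderiv w (dderiv v (vorticity u)) z = dderiv w (dderiv v ?W) z" for v w
    by (rule dderiv_cong_open[OF S z]) (rule W1)
  ultimately show "dderiv tdir (vorticity u) z
      - \<nu> * (dderiv (sdir 1) (dderiv (sdir 1) (vorticity u)) z
             + dderiv (sdir 2) (dderiv (sdir 2) (vorticity u)) z)
      + (U 1 z * dderiv (sdir 1) (vorticity u) z + U 2 z * dderiv (sdir 2) (vorticity u) z) = 0"
    using z by simp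
qed

lemma vorticity_gradient:
  assumes "NS_solution \<nu> \<Omega> u p" "open \<Omega>" "z \<in> {0<..} \<times> \<Omega>"
  shows "(norm (grad (curl (u (fst z))) (snd z)))\<^sup>2
    = (dderiv (sdir 1) (vorticity u) z)\<^sup>2 + (dderiv (sdir 2) (vorticity u) z)\<^sup>2"
proof -
  obtain t x where z: "z = (t, x)" by (cases z)
  have "partial j (curl (u t)) x = dderiv (sdir j) (vorticity u) (t, x)" for j
    using partial_slice[OF smooth_on_differentiable[OF NS_vorticity(3)[OF assms(1,2)] assms(3)[unfolded z]]]
    by simp
  then show ?thesis
    unfolding z power2_norm_eq_inner by (simp add: inner_vec_def sum_2 grad_def power2_eq_square)
qed

lemma continuous_on_enstrophy_density:
  assumes "NS_solution \<nu> \<Omega> u p" "open \<Omega>"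
  shows "continuous_on ({0<..} \<times> \<Omega>) (\<lambda>z. 1 / 2 * \<bar>curl (u (fst z)) (snd z)\<bar>\<^sup>2)"
    and "continuous_on ({0<..} \<times> \<Omega>) (\<lambda>z. (norm (grad (curl (u (fst z))) (snd z)))\<^sup>2)"
proof -
  note W = NS_vorticity(3)[OF assms]
  show "continuous_on ({0<..} \<times> \<Omega>) (\<lambda>z. 1 / 2 * \<bar>curl (u (fst z)) (snd z)\<bar>\<^sup>2)"
    by (intro continuous_intros smooth_on_continuous[OF W])
  have "continuous_on ({0<..} \<times> \<Omega>)
      (\<lambda>z. (dderiv (sdir 1) (vorticity u) z)\<^sup>2 + (dderiv (sdir 2) (vorticity u) z)\<^sup>2)"
    by (intro continuous_intros smooth_on_continuous[OF smooth_on_dderiv[OF W]])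
  then show "continuous_on ({0<..} \<times> \<Omega>) (\<lambda>z. (norm (grad (curl (u (fst z))) (snd z)))\<^sup>2)"
    using continuous_on_cong[OF refl, of "{0<..} \<times> \<Omega>"
        "\<lambda>z. (norm (grad (curl (u (fst z))) (snd z)))\<^sup>2"
        "\<lambda>z. (dderiv (sdir 1) (vorticity u) z)\<^sup>2 + (dderiv (sdir 2) (vorticity u) z)\<^sup>2"]
      vorticity_gradient[OF assms] by blast
qed

lemma dderiv_outside_support:
  fixes f :: "'a::euclidean_space \<Rightarrow> real"
  assumes "x \<notin> closure {y. f y \<noteq> 0}"
  shows "f x = 0" "dderiv v f x = 0" "dderiv w (dderiv v f) x = 0"
proof -
  let ?O = "- closure {y. f y \<noteq> 0}"
  have f0: "f y = 0" if "y \<in> ?O" for y using that closure_subset[of "{y. f y \<noteq> 0}"] by blast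
  have O: "open ?O" and x: "x \<in> ?O" using assms by auto
  have d0: "dderiv v f y = 0" if "y \<in> ?O" for y
    by (rule trans[OF dderiv_cong_open[OF O that f0]]) simp_all
  show "f x = 0" "dderiv v f x = 0" by (rule f0[OF x], rule d0[OF x])
  show "dderiv w (dderiv v f) x = 0"
    by (rule trans[OF dderiv_cong_open[OF O x d0]]) simp_all
qed

lemma deriv_eq_dderiv:
  fixes \<eta> :: "real \<Rightarrow> real"
  assumes "\<eta> differentiable at t"
  shows "deriv \<eta> t = dderiv 1 \<eta> t"
  using has_real_derivative_along_line[of \<eta> 0 t 1] assms by (simp add: DERIV_imp_deriv)

lemma laplacian_plane: "laplacian f x = partial 1 (partial 1 f) x + partial 2 (partial 2 f) x"
  by (simp add: laplacian_def sum_2)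

lemma partial_eq_dderiv: "partial j f = dderiv (axis j 1) f"
  unfolding partial_def[abs_def] ..

text \<open>The local enstrophy balance for a cut-off \<open>\<eta>(t) \<psi>(x)\<close>: the time integral of the flux is the
  dissipation minus what the cut-off itself produces through \<open>(\<partial>\<^sub>t + \<nu> \<Delta>)(\<eta> \<psi>)\<close>.\<close>

lemma time_integrated_flux:
  assumes NS: "NS_solution \<nu> \<Omega> u p" and \<Omega>: "open \<Omega>"
    and \<eta>: "test_function {0<..<2 * T} \<eta>" and \<psi>: "test_function \<Omega> \<psi>"
  shows "set_integrable lborel {0<..<2 * T} (flux \<Omega> u (cutoff \<eta> \<psi>))" (is ?integrable)
    and "(LINT t:{0<..<2 * T}|lborel. flux \<Omega> u (cutoff \<eta> \<psi>) t)
      = \<nu> * (\<integral>z. (norm (grad (curl (u (fst z))) (snd z)))\<^sup>2 * (\<eta> (fst z) * \<psi> (snd z)) \<partial>lborel)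
        - (\<integral>z. 1 / 2 * \<bar>curl (u (fst z)) (snd z)\<bar>\<^sup>2 *
            (deriv \<eta> (fst z) * \<psi> (snd z) + \<nu> * (\<eta> (fst z) * laplacian \<psi> (snd z))) \<partial>lborel)"
      (is ?identity)
    and "integrable lborel
      (\<lambda>z. (norm (grad (curl (u (fst z))) (snd z)))\<^sup>2 * (\<eta> (fst z) * \<psi> (snd z)))" (is ?dissipation)
    and "integrable lborel (\<lambda>z. 1 / 2 * \<bar>curl (u (fst z)) (snd z)\<bar>\<^sup>2 *
      (deriv \<eta> (fst z) * \<psi> (snd z) + \<nu> * (\<eta> (fst z) * laplacian \<psi> (snd z))))" (is ?production)
proof -
  define K where "K = closure {t. \<eta> t \<noteq> 0} \<times> closure {x. \<psi> x \<noteq> 0}"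
  define S where "S = {0::real<..} \<times> \<Omega>"
  define U where "U k z = u (fst z) (snd z) $ k" for k :: 2 and z
  note facts = NS_vorticity[OF NS \<Omega>, folded S_def, folded U_def]
  have s\<eta>: "smooth_on UNIV \<eta>" and s\<psi>: "smooth_on UNIV \<psi>"
    using \<eta> \<psi> by (auto simp: test_function_def)
  have K: "compact K" "K \<subseteq> S" "K \<subseteq> {0<..<2 * T} \<times> \<Omega>"
    using \<eta> \<psi> unfolding K_def S_def test_function_def by (auto intro!: compact_Times)
  have d\<eta>: "((\<lambda>s. \<eta> (t + s)) has_real_derivative deriv \<eta> t) (at 0)" for t
    using smooth_on_line_derivative[OF s\<eta>, of t 1] deriv_eq_dderiv[OF smooth_on_differentiable[OF s\<eta>]] by simp
  have d\<psi>: "((\<lambda>s. f (x + s *\<^sub>R axis j 1)) has_real_derivative partial j f x) (at 0)"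
    if "smooth_on UNIV f" for f :: "plane \<Rightarrow> real" and x j
    using smooth_on_line_derivative[OF that UNIV_I] unfolding partial_def .
  have sp: "smooth_on UNIV (partial j f)" if "smooth_on UNIV f" for f :: "plane \<Rightarrow> real" and j
    unfolding partial_eq_dderiv by (rule smooth_on_dderiv[OF that])
  let ?\<phi> = "\<lambda>z. \<eta> (fst z) * \<psi> (snd z)"
  let ?\<phi>t = "\<lambda>z. deriv \<eta> (fst z) * \<psi> (snd z)"
  let ?\<phi>x = "\<lambda>j z. \<eta> (fst z) * partial j \<psi> (snd z)"
  let ?\<phi>xx = "\<lambda>j z. \<eta> (fst z) * partial j (partial j \<psi>) (snd z)"
  let ?all = "{?\<phi>, ?\<phi>t, ?\<phi>x 1, ?\<phi>x 2, ?\<phi>xx 1, ?\<phi>xx 2}"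
  have c: "continuous_on UNIV \<eta>" "continuous_on UNIV (deriv \<eta>)" "continuous_on UNIV \<psi>"
    "continuous_on UNIV (partial j \<psi>)" "continuous_on UNIV (partial j (partial j \<psi>))" for j
  proof -
    have "deriv \<eta> = dderiv 1 \<eta>" using deriv_eq_dderiv[OF smooth_on_differentiable[OF s\<eta>]] by auto
    then show "continuous_on UNIV (deriv \<eta>)"
      using smooth_on_continuous[OF smooth_on_dderiv[OF s\<eta>]] by simp
  qed (intro smooth_on_continuous sp s\<eta> s\<psi>)+
  have cont: "continuous_on UNIV f" if "f \<in> ?all" for f
  proof -
    have "continuous_on UNIV (\<lambda>z::real \<times> plane. a (fst z) * b (snd z))"
      if "continuous_on UNIV a" "continuous_on UNIV b" for a :: "real \<Rightarrow> real" and b :: "plane \<Rightarrow> real"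
      by (intro continuous_on_mult continuous_on_compose2[OF that(1)]
          continuous_on_compose2[OF that(2)] continuous_intros) auto
    with that c show ?thesis by auto
  qed
  have z1: "\<eta> t = 0" "deriv \<eta> t = 0" if "t \<notin> closure {t. \<eta> t \<noteq> 0}" for t
    using dderiv_outside_support[OF that] deriv_eq_dderiv[OF smooth_on_differentiable[OF s\<eta>]] by auto
  have z2: "\<psi> x = 0" "partial j \<psi> x = 0" "partial j (partial j \<psi>) x = 0"
    if "x \<notin> closure {x. \<psi> x \<noteq> 0}" for x j
    using dderiv_outside_support[OF that] unfolding partial_eq_dderiv by auto
  have supp: "f z = 0" if "f \<in> ?all" "z \<notin> K" for f z
    using that z1[of "fst z"] z2[of "snd z"] unfolding K_def by (auto simp: mem_Times_iff)
  have int_density: "integrable lborel (\<lambda>z. f z * g z)"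
    if f: "continuous_on S f" and g: "continuous_on UNIV g" "\<And>z. z \<notin> K \<Longrightarrow> g z = 0" for f g :: "real \<times> plane \<Rightarrow> real"
  proof -
    obtain B where B: "\<And>z. \<bar>g z\<bar> \<le> B" using bounded_range_if_supported[OF K(1) g] by metis
    show ?thesis
      by (rule integrable_mult_supported[OF K(1) continuous_on_subset[OF f K(2)]
            borel_measurable_continuous_onI[OF g(1)] B g(2)])
  qed
  note densities = continuous_on_enstrophy_density[OF NS \<Omega>, folded S_def]
  show ?dissipation
    by (rule int_density[OF densities(2) cont[of ?\<phi>] supp[of ?\<phi>]]) auto
  let ?h = "\<lambda>z. ?\<phi>t z + \<nu> * (?\<phi>xx 1 z + ?\<phi>xx 2 z)"
  have "continuous_on UNIV ?h"
    using cont[of ?\<phi>t] cont[of "?\<phi>xx 1"] cont[of "?\<phi>xx 2"]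
    by (intro continuous_on_add continuous_on_mult_left) simp_all
  moreover have "?h z = 0" if "z \<notin> K" for z
    using supp[OF _ that, of ?\<phi>t] supp[OF _ that, of "?\<phi>xx 1"] supp[OF _ that, of "?\<phi>xx 2"] by auto
  ultimately have "integrable lborel (\<lambda>z. 1 / 2 * \<bar>curl (u (fst z)) (snd z)\<bar>\<^sup>2 * ?h z)"
    by (rule int_density[OF densities(1)])
  then show ?production unfolding laplacian_plane by (simp add: distrib_left)
  have balance: "(\<integral>z. 1 / 2 * (vorticity u z)\<^sup>2 * (U 1 z * ?\<phi>x 1 z + U 2 z * ?\<phi>x 2 z) \<partial>lborel)
    = \<nu> * (\<integral>z. ((dderiv (sdir 1) (vorticity u) z)\<^sup>2 + (dderiv (sdir 2) (vorticity u) z)\<^sup>2) * ?\<phi> z \<partial>lborel)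
      - (\<integral>z. 1 / 2 * (vorticity u z)\<^sup>2 * (?\<phi>t z + \<nu> * (?\<phi>xx 1 z + ?\<phi>xx 2 z)) \<partial>lborel)"
  proof (rule enstrophy_balance[OF facts(1) K(1,2) facts(3,2,2) facts(5) facts(4), where \<phi> = ?\<phi>])
    show "((\<lambda>s. ?\<phi> (z + s *\<^sub>R tdir)) has_real_derivative ?\<phi>t z) (at 0)" for z
      using DERIV_cmult_right[OF d\<eta>[of "fst z"], of "\<psi> (snd z)"] by simp
    show "((\<lambda>s. ?\<phi> (z + s *\<^sub>R sdir 1)) has_real_derivative ?\<phi>x 1 z) (at 0)"
      "((\<lambda>s. ?\<phi> (z + s *\<^sub>R sdir 2)) has_real_derivative ?\<phi>x 2 z) (at 0)" for z
      using DERIV_cmult[OF d\<psi>[OF s\<psi>], of "\<eta> (fst z)"] by simp_all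
    show "((\<lambda>s. ?\<phi>x 1 (z + s *\<^sub>R sdir 1)) has_real_derivative ?\<phi>xx 1 z) (at 0)"
      "((\<lambda>s. ?\<phi>x 2 (z + s *\<^sub>R sdir 2)) has_real_derivative ?\<phi>xx 2 z) (at 0)" for z
      using DERIV_cmult[OF d\<psi>[OF sp[OF s\<psi>]], of "\<eta> (fst z)"] by simp_all
  qed (use cont supp in blast)+
  have G: "(norm (grad (curl (u (fst z))) (snd z)))\<^sup>2 * ?\<phi> z
      = ((dderiv (sdir 1) (vorticity u) z)\<^sup>2 + (dderiv (sdir 2) (vorticity u) z)\<^sup>2) * ?\<phi> z" for z
  proof (cases "z \<in> S")
    case True
    then show ?thesis using vorticity_gradient[OF NS \<Omega>, folded S_def] by simp
  next
    case False
    then have "?\<phi> z = 0" using K(2) supp[of ?\<phi> z] by auto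
    then show ?thesis by simp
  qed
  let ?F = "\<lambda>z. 1 / 2 * (vorticity u z)\<^sup>2 * (U 1 z * ?\<phi>x 1 z + U 2 z * ?\<phi>x 2 z)"
  have int: "integrable lborel (\<lambda>z. (1 / 2 * (vorticity u z)\<^sup>2 * U j z) * ?\<phi>x j z)" if "j = 1 \<or> j = 2" for j
  proof (rule int_density)
    have mem: "?\<phi>x j \<in> ?all" using that by auto
    show "continuous_on UNIV (?\<phi>x j)" "z \<notin> K \<Longrightarrow> ?\<phi>x j z = 0" for z
      by (rule cont[OF mem], rule supp[OF mem])
    show "continuous_on S (\<lambda>z. 1 / 2 * (vorticity u z)\<^sup>2 * U j z)"
      by (intro continuous_intros smooth_on_continuous facts)
  qed
  have F: "integrable lborel ?F"
    using Bochner_Integration.integrable_add[OF int[of 1] int[of 2]] by (simp add: algebra_simps)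
  have F0: "?F (t, x) = 0" if "t \<notin> {0<..<2 * T} \<or> x \<notin> \<Omega>" for t x
  proof -
    have "(t, x) \<notin> K" using that K(3) by blast
    then have "?\<phi>x 1 (t, x) = 0" "?\<phi>x 2 (t, x) = 0"
      using supp[of "?\<phi>x 1" "(t, x)"] supp[of "?\<phi>x 2" "(t, x)"] by simp_all
    then show ?thesis by auto
  qed
  have Ff: "1 / 2 * \<bar>curl (u t) x\<bar>\<^sup>2 * (u t x \<bullet> grad (cutoff \<eta> \<psi> t) x) = ?F (t, x)" for t x
  proof -
    have "partial j (cutoff \<eta> \<psi> t) x = \<eta> t * partial j \<psi> x" for j
      unfolding partial_def cutoff_def[abs_def]
      by (rule dderiv_bounded_linear[OF bounded_linear_mult_right smooth_on_differentiable[OF s\<psi> UNIV_I]])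
    then show ?thesis by (simp add: inner_vec_def sum_2 grad_def U_def)
  qed
  note fubini = iterated_set_integral_eq_integral[OF F F0 Ff]
  show ?integrable using fubini(2) unfolding flux_def[abs_def] .
  have "(LINT t:{0<..<2 * T}|lborel. flux \<Omega> u (cutoff \<eta> \<psi>) t) = integral\<^sup>L lborel ?F"
    using fubini(1) unfolding flux_def .
  also note balance
  finally show ?identity
    unfolding G laplacian_plane by (simp add: distrib_left)
qed

section \<open>Cut-offs\<close>

lemma test_function_dominated:
  assumes \<psi>0: "test_function B \<psi>0" and sm: "smooth_on UNIV \<psi>" and B: "B \<subseteq> \<Omega>"
    and le: "\<And>x. 0 \<le> \<psi> x \<and> \<psi> x \<le> \<psi>0 x"
  shows "test_function \<Omega> \<psi>"
proof -
  have "{x. \<psi> x \<noteq> 0} \<subseteq> {x. \<psi>0 x \<noteq> 0}" 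
  proof
    fix x assume "x \<in> {x. \<psi> x \<noteq> 0}"
    with le[of x] show "x \<in> {x. \<psi>0 x \<noteq> 0}" by auto
  qed
  then have "closure {x. \<psi> x \<noteq> 0} \<subseteq> closure {x. \<psi>0 x \<noteq> 0}" by (rule closure_mono)
  moreover from this have "compact (closure {x. \<psi> x \<noteq> 0})"
    using \<psi>0 compact_Int_closed[OF _ closed_closure, of "closure {x. \<psi>0 x \<noteq> 0}" "{x. \<psi> x \<noteq> 0}"]
    by (simp add: test_function_def Int_absorb1)
  ultimately show ?thesis using \<psi>0 sm B unfolding test_function_def by blast
qed

lemma bound_if_quotient_bound:
  fixes a f r C :: real
  assumes "\<bar>a\<bar> / f powr r \<le> C" "0 \<le> f" "f = 0 \<Longrightarrow> a = 0"
  shows "\<bar>a\<bar> \<le> C * f powr r"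
proof (cases "f = 0")
  case False
  then have "0 < f powr r" using assms(2) by simp
  with assms(1) show ?thesis by (simp add: field_simps)
qed (use assms(3) in simp)

text \<open>The quotient bounds say nothing where the cut-off vanishes. There the spatial Laplacian is
  almost everywhere \<open>0\<close>, and the time derivative is \<open>0\<close> at a minimum.\<close>

lemma AE_laplacian_bound:
  assumes "smooth_on UNIV \<psi>" "\<And>x. 0 \<le> \<psi> x" "spatial_bounds \<delta> C0 R \<psi>"
  shows "AE x in lborel. \<bar>laplacian \<psi> x\<bar> \<le> C0 / R\<^sup>2 * \<psi> x powr (2 * \<delta> - 1)"
proof -
  have "AE x in lborel. \<psi> x = 0 \<longrightarrow> partial 1 (partial 1 \<psi>) x = 0"
    "AE x in lborel. \<psi> x = 0 \<longrightarrow> partial 2 (partial 2 \<psi>) x = 0"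
    unfolding partial_eq_dderiv by (intro AE_second_derivative_zero_on_zeros assms)+
  then show ?thesis
  proof eventually_elim
    case (elim x)
    show ?case
      by (rule bound_if_quotient_bound)
        (use assms elim in \<open>auto simp: spatial_bounds_def laplacian_plane\<close>)
  qed
qed

lemma time_cutoff_deriv_bound:
  assumes "time_cutoff \<delta> C0 T \<eta>"
  shows "\<bar>deriv \<eta> t\<bar> \<le> C0 / T * \<eta> t powr \<delta>"
proof (rule bound_if_quotient_bound)
  assume z: "\<eta> t = 0"
  have s: "smooth_on UNIV \<eta>" and pos: "\<And>t. 0 \<le> \<eta> t"
    using assms by (auto simp: time_cutoff_def test_function_def)
  have "(\<eta> has_real_derivative dderiv 1 \<eta> t) (at t)"
    using has_real_derivative_along_line[of \<eta> 0 t 1] smooth_on_differentiable[OF s] by simp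
  then have "dderiv 1 \<eta> t = 0"
    by (rule DERIV_local_min[of _ _ _ 1]) (use z pos in auto)
  then show "deriv \<eta> t = 0" using deriv_eq_dderiv[OF smooth_on_differentiable[OF s]] by simp
qed (use assms in \<open>auto simp: time_cutoff_def\<close>)

section \<open>Coverings and their cut-offs\<close>

text \<open>Along a direction \<open>v\<close> orthogonal to \<open>a\<close> the squared equation is quadratic with leading coefficient
  \<open>|v|\<^sup>2 \<noteq> 0\<close>, so that each line in this direction meets the cone at most twice.\<close>

lemma null_set_cone:
  fixes a :: "'a::euclidean_space"
  assumes dim: "2 \<le> DIM('a)" and k: "k \<noteq> 0"
  shows "{x. a \<bullet> x = k * norm x} \<in> null_sets lborel"
proof -
  obtain v where v: "v \<noteq> 0" "a \<bullet> v = 0"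
    using orthogonal_to_vector_exists[OF dim] unfolding orthogonal_def by metis
  show ?thesis
  proof (rule null_set_if_countable_line_sections[where v = v])
    show "{x. a \<bullet> x = k * norm x} \<in> sets borel"
      by (intro borel_closed closed_Collect_eq continuous_intros)
    fix x :: 'a
    let ?p = "[:(norm x)\<^sup>2 - (a \<bullet> x / k)\<^sup>2, 2 * (x \<bullet> v), (norm v)\<^sup>2:]"
    have "poly ?p s = 0" if "x + s *\<^sub>R v \<in> {x. a \<bullet> x = k * norm x}" for s
    proof -
      have "norm (x + s *\<^sub>R v) = a \<bullet> x / k" using that v(2) k by (simp add: inner_add_right field_simps)
      then have "(norm (x + s *\<^sub>R v))\<^sup>2 = (a \<bullet> x / k)\<^sup>2" by simp
      then show ?thesis
        unfolding power2_norm_eq_inner by (simp add: inner_simps inner_commute algebra_simps power2_eq_square)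
    qed
    then have "{s. x + s *\<^sub>R v \<in> {x. a \<bullet> x = k * norm x}} \<subseteq> {s. poly ?p s = 0}" by auto
    moreover have "finite {s. poly ?p s = 0}" using v(1) by (intro poly_roots_finite) auto
    ultimately show "countable {s. x + s *\<^sub>R v \<in> {x. a \<bullet> x = k * norm x}}"
      by (meson countable_finite countable_subset)
  qed
qed

text \<open>The point of the closed ball \<open>B(0,R0)\<close> that is nearest to \<open>x\<close>.\<close>

definition radial_proj :: "real \<Rightarrow> plane \<Rightarrow> plane" where
  "radial_proj R0 x = (if norm x < R0 then x else (R0 / norm x) *\<^sub>R x)"

lemma norm_radial_proj: "0 < R0 \<Longrightarrow> R0 \<le> norm x \<Longrightarrow> norm (radial_proj R0 x) = R0"
  by (auto simp: radial_proj_def)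

lemma radial_proj_closer:
  assumes R0: "0 < R0" and y: "norm y \<le> R0"
  shows "dist y (radial_proj R0 x) \<le> dist y x"
proof (cases "norm x < R0")
  case False
  define s where "s = norm x / R0"
  let ?z = "radial_proj R0 x"
  have s: "1 \<le> s" using False R0 by (simp add: s_def)
  have nz: "norm ?z = R0" using False R0 by (intro norm_radial_proj) auto
  have x: "x = s *\<^sub>R ?z" using False R0 by (auto simp: radial_proj_def s_def)
  have "?z \<bullet> y \<le> R0 * R0"
    using order_trans[OF norm_cauchy_schwarz[of ?z y, unfolded nz] mult_left_mono[OF y less_imp_le[OF R0]]] .
  then have "2 * (s - 1) * (?z \<bullet> y) \<le> 2 * (s - 1) * R0\<^sup>2"
    using s by (intro mult_left_mono) (auto simp: power2_eq_square)
  moreover have "0 \<le> (s - 1)\<^sup>2 * R0\<^sup>2" by simp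
  moreover have "(norm (s *\<^sub>R z - y))\<^sup>2 - (norm (z - y))\<^sup>2
      = (s\<^sup>2 - 1) * (norm z)\<^sup>2 - 2 * (s - 1) * (z \<bullet> y)" for z
    unfolding power2_norm_eq_inner
    by (simp add: inner_simps inner_commute algebra_simps power2_eq_square)
  from this[of ?z] have "(norm (s *\<^sub>R ?z - y))\<^sup>2 - (norm (?z - y))\<^sup>2
      = (s\<^sup>2 - 1) * R0\<^sup>2 - 2 * (s - 1) * (?z \<bullet> y)"
    by (simp only: nz)
  ultimately have "(norm (?z - y))\<^sup>2 \<le> (norm (s *\<^sub>R ?z - y))\<^sup>2"
    by (simp add: algebra_simps power2_eq_square)
  then have "norm (?z - y) \<le> norm (x - y)"
    using x by (metis norm_ge_zero power2_le_imp_le)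
  then show ?thesis by (simp add: dist_norm norm_minus_commute)
qed (simp add: radial_proj_def)

text \<open>The multiplicity of a covering is controlled in \<open>B(0,R0)\<close> only, whereas the cut-offs live on
  \<open>B(0,2R0)\<close>. A cut-off that acts beyond the circle \<open>S(0,R0)\<close> also counts at the radial projection: the
  projection stays in the sector \<open>cone_shell\<close>, and it moves points closer to the centre \<open>x0\<close>.\<close>

lemma local_cutoff_nonzero:
  assumes lc: "local_cutoff \<delta> C0 R0 \<psi>0 x0 R \<psi>" and x0: "x0 \<in> ball 0 R0" and R: "0 < R" "R \<le> R0"
    and nz: "\<psi> x \<noteq> 0" and x: "norm x < 2 * R0"
  shows "radial_proj R0 x \<in> ball x0 (2 * R)"
proof (cases "ball x0 R \<subseteq> ball 0 R0")
  case True
  then have "closure {x. \<psi> x \<noteq> 0} \<subseteq> ball x0 (2 * R)"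
    using lc by (auto simp: local_cutoff_def test_function_def)
  then have "x \<in> ball x0 (2 * R)" using nz closure_subset[of "{x. \<psi> x \<noteq> 0}"] by auto
  then show ?thesis using radial_proj_closer[of R0 x0 x] x0 R by auto
next
  case False
  show ?thesis
  proof (cases "norm x < R0")
    case True
    then have "x \<in> ball x0 (2 * R)" using False lc nz unfolding local_cutoff_def by auto
    then show ?thesis using True by (simp add: radial_proj_def)
  next
    case nx: False
    then have "x \<in> cone_shell R0 x0 (2 * R)"
      using False lc nz x unfolding local_cutoff_def by (metis less_imp_le not_less)
    then obtain s y where y: "x = s *\<^sub>R y" "norm y = R0" "y \<in> ball x0 (2 * R)" "1 \<le> s"
      by (auto simp: cone_shell_def)
    then have "radial_proj R0 x = y" using nx R by (auto simp: radial_proj_def)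
    with y(3) show ?thesis by simp
  qed
qed

lemma optimal_covering_radius_pos:
  assumes "optimal_covering K1 K2 R0 R n x" "0 < R0"
  shows "0 < R"
proof (rule ccontr)
  assume "\<not> 0 < R"
  then have "(\<Union>i\<in>{1..n}. ball (x i) R) = {}" by (simp add: ball_empty)
  moreover have "0 \<in> ball (0::plane) R0" using assms(2) by simp
  ultimately show False using assms(1) unfolding optimal_covering_def by blast
qed

lemma optimal_covering_closed:
  assumes "optimal_covering K1 K2 R0 R n x" "0 < R0" "norm z \<le> R0"
  shows "\<exists>i\<in>{1..n}. dist (x i) z \<le> R"
proof -
  have "closed (\<Union>i\<in>{1..n}. cball (x i) R)" by (intro closed_UN) auto
  moreover have "ball 0 R0 \<subseteq> (\<Union>i\<in>{1..n}. cball (x i) R)"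
    using assms(1) ball_subset_cball unfolding optimal_covering_def by blast
  ultimately have "closure (ball 0 R0) \<subseteq> (\<Union>i\<in>{1..n}. cball (x i) R)" by (rule closure_minimal[rotated])
  then have "cball 0 R0 \<subseteq> (\<Union>i\<in>{1..n}. cball (x i) R)" using assms(2) by simp
  moreover have "z \<in> cball 0 R0" using assms(3) by simp
  ultimately obtain i where "i \<in> {1..n}" "z \<in> cball (x i) R" by blast
  then show ?thesis by (intro bexI[of _ i]) (simp_all only: mem_cball)
qed

text \<open>At radius \<open>R = 5/9 R0\<close> there are \<open>n \<ge> (9/5)\<^sup>2 > 3\<close> balls, and all of the doubled balls
  contain the origin, because their radius \<open>2 R\<close> exceeds \<open>R0\<close>.\<close>

lemma four_le_multiplicity_bound:
  assumes "0 < R0" and ex: "\<And>R. 0 < R \<Longrightarrow> R \<le> R0 \<Longrightarrow> \<exists>n x. optimal_covering K1 K2 R0 R n x"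
  shows "4 \<le> K2"
proof -
  obtain n x where c: "optimal_covering K1 K2 R0 (5 / 9 * R0) n x"
    using ex[of "5 / 9 * R0"] assms(1) by auto
  have "(R0 / (5 / 9 * R0))\<^sup>2 \<le> real n" using c unfolding optimal_covering_def by blast
  then have "3 < real n" using assms(1) by (simp add: power2_eq_square)
  then have n: "4 \<le> real n" by simp
  have "{i\<in>{1..n}. 0 \<in> ball (x i) (2 * (5 / 9 * R0))} = {1..n}"
    using c assms(1) by (force simp: optimal_covering_def)
  moreover have "real (card {i\<in>{1..n}. 0 \<in> ball (x i) (2 * (5 / 9 * R0))}) \<le> K2"
  proof -
    have "0 \<in> ball (0::plane) R0" using assms(1) by simp
    then show ?thesis using c unfolding optimal_covering_def by blast
  qed
  ultimately show ?thesis using n by simp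
qed

lemma laplacian_cong_open:
  assumes "open S" "x \<in> S" "\<And>y. y \<in> S \<Longrightarrow> f y = g y"
  shows "laplacian f x = laplacian g x"
  unfolding laplacian_def
  by (intro sum.cong refl partial_cong_open[OF assms(1,2)] partial_cong_open[OF assms(1) _ assms(3)])

lemma laplacian_const: "laplacian (\<lambda>x. c) x = 0"
  by (simp add: laplacian_def partial_def[abs_def])

context
  fixes \<delta> C0 R0 K1 K2 R :: real and n :: nat and x :: "nat \<Rightarrow> plane"
    and \<psi>0 :: "plane \<Rightarrow> real" and \<psi> :: "plane \<Rightarrow> real \<Rightarrow> plane \<Rightarrow> real"
  assumes R0: "0 < R0" and RR0: "R \<le> R0"
    and macro: "macro_cutoff \<delta> C0 R0 \<psi>0" and family: "cutoff_family \<delta> C0 R0 \<psi>0 \<psi>"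
    and cover: "optimal_covering K1 K2 R0 R n x"
begin

private lemma Rpos: "0 < R"
  using optimal_covering_radius_pos[OF cover R0] .

private lemma centre: "i \<in> {1..n} \<Longrightarrow> x i \<in> ball 0 R0"
  using cover unfolding optimal_covering_def by blast

lemma covering_local_cutoff: "i \<in> {1..n} \<Longrightarrow> local_cutoff \<delta> C0 R0 \<psi>0 (x i) R (\<psi> (x i) R)"
  using family Rpos RR0 centre unfolding cutoff_family_def by blast

lemma card_active_cutoffs_le:
  assumes "norm y < 2 * R0"
  shows "real (card {i\<in>{1..n}. \<psi> (x i) R y \<noteq> 0}) \<le> K2"
proof -
  let ?I = "{i\<in>{1..n}. \<psi> (x i) R y \<noteq> 0}"
  define V where "V = (\<Inter>i\<in>?I. ball (x i) (2 * R))"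
  have "open V" unfolding V_def by (intro open_INT) auto
  moreover have "radial_proj R0 y \<in> V" unfolding V_def
    using local_cutoff_nonzero[OF covering_local_cutoff centre Rpos RR0 _ assms] by auto
  moreover have "radial_proj R0 y \<in> closure (ball 0 R0)"
    using R0 norm_radial_proj[OF R0, of y] by (cases "norm y < R0") (auto simp: radial_proj_def)
  ultimately have "V \<inter> ball 0 R0 \<noteq> {}"
    using open_Int_closure_eq_empty[of V "ball 0 R0"] by blast
  then obtain w where w: "w \<in> V" "w \<in> ball 0 R0" by blast
  have "card ?I \<le> card {i\<in>{1..n}. w \<in> ball (x i) (2 * R)}"
    by (rule card_mono) (use w(1) in \<open>auto simp: V_def\<close>)
  moreover have "real (card {i\<in>{1..n}. w \<in> ball (x i) (2 * R)}) \<le> K2"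
    using cover w(2) unfolding optimal_covering_def by blast
  ultimately show ?thesis by linarith
qed

text \<open>If all cut-offs act at a point outside \<open>B(0,R0)\<close>, then all centres have distance less than
  \<open>2R\<close> from some point of the circle; the ball that covers the antipode of that point has to
  be large.\<close>

lemma all_active_outside_imp_large_radius:
  assumes "R0 \<le> norm y" "norm y < 2 * R0" "\<And>i. i \<in> {1..n} \<Longrightarrow> \<psi> (x i) R y \<noteq> 0"
  shows "2 * R0 \<le> 3 * R"
proof -
  let ?z = "radial_proj R0 y"
  have nz: "norm ?z = R0" using norm_radial_proj[OF R0 assms(1)] .
  obtain i where i: "i \<in> {1..n}" "dist (x i) (- ?z) \<le> R"
    using optimal_covering_closed[OF cover R0, of "- ?z"] nz by auto
  have "dist (x i) ?z < 2 * R"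
    using local_cutoff_nonzero[OF covering_local_cutoff[OF i(1)] centre[OF i(1)] Rpos RR0 assms(3)[OF i(1)] assms(2)]
    by simp
  then have "dist ?z (- ?z) < 3 * R" using i(2) dist_triangle3[of ?z "- ?z" "x i"] by linarith
  moreover have "dist ?z (- ?z) = 2 * R0"
  proof -
    have "?z - - ?z = 2 *\<^sub>R ?z" by (simp add: scaleR_2)
    then show ?thesis unfolding dist_norm using nz by simp
  qed
  ultimately show ?thesis by simp
qed

text \<open>Near almost every point of \<open>B(0,2R0)\<close> one of the local cut-offs coincides with \<open>\<psi>0\<close>: the
  one of a ball that contains the point or, beyond the circle \<open>S(0,R0)\<close>, its radial projection.
  A projection that lies in no open ball lies on the circle \<open>S(x\<^sub>i,R)\<close> for some \<open>i\<close>. If this circle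
  differs from \<open>S(0,R0)\<close>, this confines the point to a null cone; otherwise the cut-off is \<open>\<psi>0\<close>
  itself.\<close>

lemma AE_local_cutoff_eq_macro:
  "AE y in lborel. norm y < 2 * R0 \<longrightarrow> (\<exists>i\<in>{1..n}. \<psi> (x i) R y = \<psi>0 y \<and>
     laplacian (\<psi> (x i) R) y = laplacian \<psi>0 y \<and> (norm y < R0 \<longrightarrow> laplacian (\<psi> (x i) R) y = 0))"
proof -
  \<comment> \<open>the intersection points \<open>z\<close> of \<open>S(0,R0)\<close> and \<open>S(x\<^sub>i,R)\<close> satisfy \<open>2 x\<^sub>i \<bullet> z = k i\<close>\<close>
  define k where "k i = (norm (x i))\<^sup>2 + R0\<^sup>2 - R\<^sup>2" for i
  have "R\<^sup>2 \<le> R0\<^sup>2" using Rpos RR0 by (intro power_mono) auto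
  then have k: "k i \<noteq> 0" if "x i \<noteq> 0" for i
    using that unfolding k_def by (smt (verit) zero_less_norm_iff zero_less_power)
  have "AE y in lborel. y \<notin> {y. (2 * R0) *\<^sub>R x i \<bullet> y = k i * norm y}" if "x i \<noteq> 0" for i
    by (intro AE_not_in null_set_cone k that) simp
  then have cones: "AE y in lborel. \<forall>i\<in>{1..n}. x i \<noteq> 0 \<longrightarrow> (2 * R0) *\<^sub>R x i \<bullet> y \<noteq> k i * norm y"
    by (intro AE_finite_allI) auto
  have "sphere (0::plane) R0 \<in> null_sets lborel"
    using negligible_sphere[of "0::plane" R0] by (simp add: negligible_iff_null_sets null_sets_completion_iff)
  from AE_not_in[OF this] cones show ?thesis
  proof eventually_elim
    case (elim y)
    show ?case
    proof
      assume y: "norm y < 2 * R0"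
      consider "norm y < R0" | "R0 < norm y" using elim(1) by fastforce
      then show "\<exists>i\<in>{1..n}. \<psi> (x i) R y = \<psi>0 y \<and> laplacian (\<psi> (x i) R) y = laplacian \<psi>0 y \<and>
        (norm y < R0 \<longrightarrow> laplacian (\<psi> (x i) R) y = 0)"
      proof cases
        case 1
        then have "y \<in> ball 0 R0" by simp
        then obtain i where i: "i \<in> {1..n}" "y \<in> ball (x i) R"
          using cover unfolding optimal_covering_def by blast
        let ?S = "ball (x i) R \<inter> ball 0 R0"
        have S: "open ?S" "y \<in> ?S" using i(2) 1 by auto
        have one: "\<psi> (x i) R w = 1" if "w \<in> ?S" for w
          using covering_local_cutoff[OF i(1)] that unfolding local_cutoff_def by blast
        have one0: "\<psi>0 w = 1" if "w \<in> ?S" for w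
          using macro that unfolding macro_cutoff_def by blast
        have "laplacian (\<psi> (x i) R) y = 0" "laplacian \<psi>0 y = 0"
          using laplacian_cong_open[OF S one] laplacian_cong_open[OF S one0] laplacian_const by auto
        then show ?thesis using i(1) one[OF S(2)] one0[OF S(2)] by (intro bexI[of _ i]) auto
      next
        case 2
        let ?z = "radial_proj R0 y"
        have nz: "norm ?z = R0" using norm_radial_proj[OF R0, of y] 2 by simp
        have zy: "?z = (R0 / norm y) *\<^sub>R y" using 2 by (simp add: radial_proj_def)
        obtain i where i: "i \<in> {1..n}" "dist (x i) ?z \<le> R"
          using optimal_covering_closed[OF cover R0, of ?z] nz by auto
        show ?thesis
        proof (cases "dist (x i) ?z < R")
          case True
          let ?A = "{w::plane. R0 < norm w}"
          let ?S = "(?A \<inter> (\<lambda>w. (R0 / norm w) *\<^sub>R w) -` ball (x i) R) \<inter> ball 0 (2 * R0)"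
          have "open ?A" by (intro open_Collect_less continuous_intros)
          moreover have "continuous_on ?A (\<lambda>w. (R0 / norm w) *\<^sub>R w)"
            using R0 by (auto intro!: continuous_intros)
          ultimately have "open (?A \<inter> (\<lambda>w. (R0 / norm w) *\<^sub>R w) -` ball (x i) R)"
            by (intro continuous_open_preimage) auto
          then have "open ?S" by (rule open_Int) auto
          moreover have "y \<in> ?S" using 2 y True zy by simp
          ultimately have S: "open ?S" "y \<in> ?S" by auto
          have "\<not> ball (x i) R \<subseteq> ball 0 R0" using True nz by (auto simp: subset_iff)
          then have "\<psi> (x i) R w = \<psi>0 w" if "w \<in> cone_shell R0 (x i) R" for w
            using covering_local_cutoff[OF i(1)] that unfolding local_cutoff_def by blast
          moreover have "w \<in> cone_shell R0 (x i) R" if "w \<in> ?S" for w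
          proof -
            have "w = (norm w / R0) *\<^sub>R ((R0 / norm w) *\<^sub>R w)" "norm ((R0 / norm w) *\<^sub>R w) = R0"
              "1 \<le> norm w / R0" "norm w / R0 \<le> 2" using that R0 by (auto simp: field_simps)
            then show ?thesis using that unfolding cone_shell_def
              by (intro CollectI exI[of _ "norm w / R0"] exI[of _ "(R0 / norm w) *\<^sub>R w"]) (use R0 in auto)
          qed
          ultimately have eq: "\<psi> (x i) R w = \<psi>0 w" if "w \<in> ?S" for w using that by blast
          show ?thesis
            using i(1) 2 eq[OF S(2)] laplacian_cong_open[OF S eq] by (intro bexI[of _ i]) auto
        next
          case False
          then have "(norm (x i - ?z))\<^sup>2 = R\<^sup>2" using i(2) by (simp add: dist_norm)
          moreover have "(norm (x i - ?z))\<^sup>2 = (norm (x i))\<^sup>2 + (norm ?z)\<^sup>2 - 2 * (x i \<bullet> ?z)"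
            unfolding power2_norm_eq_inner by (simp add: inner_simps inner_commute)
          ultimately have "2 * (x i \<bullet> ?z) = k i" unfolding k_def nz by linarith
          then have "(2 * R0) *\<^sub>R x i \<bullet> y = k i * norm y"
            using less_trans[OF R0 2] unfolding zy by (simp add: field_simps)
          with elim(2) i(1) have xi: "x i = 0" by blast
          with False i(2) nz have "R = R0" by simp
          with xi family have "\<psi> (x i) R = \<psi>0" by (simp add: cutoff_family_def)
          with i(1) 2 show ?thesis by (intro bexI[of _ i]) auto
        qed
      qed
    qed
  qed
qed

end

section \<open>What the cut-offs produce\<close>

lemma abs_sum_le_with_exception:
  fixes a b :: "'i \<Rightarrow> real"
  assumes I: "finite I" "j \<in> I"
    and a: "\<And>i. i \<in> I \<Longrightarrow> \<bar>a i\<bar> \<le> A" and b: "\<And>i. i \<in> I \<Longrightarrow> \<bar>b i\<bar> \<le> B" and bj: "\<bar>b j\<bar> \<le> B'"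
  shows "\<bar>\<Sum>i\<in>I. a i + b i\<bar> \<le> real (card I) * A + (real (card I) - 1) * B + B'"
proof -
  have "\<bar>sum a I\<bar> \<le> real (card I) * A"
    using sum_norm_bound[of I a A] a by simp
  moreover have "\<bar>sum b (I - {j})\<bar> \<le> real (card (I - {j})) * B"
    using sum_norm_bound[of "I - {j}" b B] b by simp
  moreover have "real (card (I - {j})) = real (card I) - 1"
    using I card_gt_0_iff[of I] by (auto simp: card_Diff_singleton of_nat_diff Suc_leI)
  moreover have "(\<Sum>i\<in>I. a i + b i) = sum a I + (b j + sum b (I - {j}))"
    using I by (simp add: sum.distrib sum.remove)
  ultimately show ?thesis using bj by (simp only:)
qed

text \<open>The count behind the pointwise bound on the production, in units of \<open>\<nu> C0 / R0\<^sup>2\<close>: of \<open>m\<close> active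
  cut-offs each contributes \<open>1\<close> by its time derivative, one contributes \<open>e\<close> by its Laplacian and the
  others \<open>\<rho> = (R0/R)\<^sup>2\<close>. Replacing a contribution \<open>\<rho> \<le> n\<close> by \<open>e\<close> pays for the \<open>m\<close> time derivatives as
  long as \<open>m + e \<le> n\<close>. Otherwise \<open>m = n\<close>, and \<open>n + 3 (n - 1) + 1 \<le> 4 n\<close>.\<close>

lemma production_count:
  fixes m n :: nat and \<rho> e K :: real
  assumes m: "1 \<le> m" "m \<le> n" "real m \<le> K" and \<rho>: "\<rho> \<le> real n" and K: "4 \<le> K"
    and e: "e = 0 \<or> e = 1 \<and> (m < n \<or> \<rho> \<le> 3)"
  shows "real m + (real m - 1) * \<rho> + e \<le> real n * K"
proof (cases "real m + e \<le> real n")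
  case True
  have "(real m - 1) * \<rho> \<le> (real m - 1) * real n" using m(1) \<rho> by (intro mult_left_mono) auto
  with True have "real m + (real m - 1) * \<rho> + e \<le> real m * real n" by (simp add: algebra_simps)
  also have "\<dots> \<le> real n * K" using m(3) mult_left_mono[OF m(3), of "real n"] by (simp add: mult.commute)
  finally show ?thesis .
next
  case False
  have e1: "e = 1" and nm: "\<not> m < n" and \<rho>3: "\<rho> \<le> 3" using False e m(2) by auto
  then have mn: "m = n" using m(2) by simp
  have "(real n - 1) * \<rho> \<le> (real n - 1) * 3" using m mn \<rho>3 by (intro mult_left_mono) auto
  then have "real m + (real m - 1) * \<rho> + e \<le> real n * 4" using mn e1 by (simp add: algebra_simps)
  also have "\<dots> \<le> real n * K" using K by (intro mult_left_mono) auto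
  finally show ?thesis .
qed

lemma powr_scale_bounds:
  fixes s f g :: real
  assumes "1 / 2 \<le> \<delta>" "\<delta> < 1" "0 \<le> s" "s \<le> 1" "0 \<le> f" "f \<le> g" "g \<le> 1"
  shows "s powr \<delta> * f \<le> (s * g) powr (2 * \<delta> - 1)"
    and "s * f powr (2 * \<delta> - 1) \<le> (s * g) powr (2 * \<delta> - 1)"
proof -
  have sg: "(s * g) powr (2 * \<delta> - 1) = s powr (2 * \<delta> - 1) * g powr (2 * \<delta> - 1)"
    using assms by (intro powr_mult)
  have "f \<le> f powr (2 * \<delta> - 1)"
    using powr_mono'[of "2 * \<delta> - 1" 1 f] assms by simp
  moreover have fg: "f powr (2 * \<delta> - 1) \<le> g powr (2 * \<delta> - 1)"
    using assms by (intro powr_mono2) auto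
  moreover have "s powr \<delta> \<le> s powr (2 * \<delta> - 1)"
    using assms by (intro powr_mono') auto
  ultimately show "s powr \<delta> * f \<le> (s * g) powr (2 * \<delta> - 1)"
    unfolding sg using assms by (intro mult_mono) auto
  have "s \<le> s powr (2 * \<delta> - 1)" using powr_mono'[of "2 * \<delta> - 1" 1 s] assms by simp
  with fg show "s * f powr (2 * \<delta> - 1) \<le> (s * g) powr (2 * \<delta> - 1)"
    unfolding sg using assms by (intro mult_mono) auto
qed

lemma macro_cutoff_support:
  assumes "macro_cutoff \<delta> C0 R0 \<psi>0" "\<psi>0 y \<noteq> 0"
  shows "norm y < 2 * R0"
proof -
  have "closure {x. \<psi>0 x \<noteq> 0} \<subseteq> ball 0 (2 * R0)"
    using assms(1) by (simp add: macro_cutoff_def test_function_def)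
  moreover have "y \<in> closure {x. \<psi>0 x \<noteq> 0}"
    using assms(2) closure_subset[of "{x. \<psi>0 x \<noteq> 0}"] by auto
  ultimately show ?thesis by auto
qed

context
  fixes \<delta> C0 R0 K1 K2 R :: real and n :: nat and x :: "nat \<Rightarrow> plane"
    and \<psi>0 :: "plane \<Rightarrow> real" and \<psi> :: "plane \<Rightarrow> real \<Rightarrow> plane \<Rightarrow> real"
  assumes R0: "0 < R0" and RR0: "R \<le> R0"
    and macro: "macro_cutoff \<delta> C0 R0 \<psi>0" and family: "cutoff_family \<delta> C0 R0 \<psi>0 \<psi>"
    and cover: "optimal_covering K1 K2 R0 R n x"
begin

private lemma cutoff_le: "i \<in> {1..n} \<Longrightarrow> 0 \<le> \<psi> (x i) R y \<and> \<psi> (x i) R y \<le> \<psi>0 y"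
  using covering_local_cutoff[OF R0 RR0 macro family cover] unfolding local_cutoff_def by blast

lemma AE_sum_cutoffs:
  "AE y in lborel. \<psi>0 y \<le> (\<Sum>i=1..n. \<psi> (x i) R y) \<and> (\<Sum>i=1..n. \<psi> (x i) R y) \<le> K2 * \<psi>0 y"
  using AE_local_cutoff_eq_macro[OF R0 RR0 macro family cover]
proof eventually_elim
  case (elim y)
  show ?case
  proof (cases "\<psi>0 y = 0")
    case True
    then have "(\<Sum>i=1..n. \<psi> (x i) R y) = 0"
      using cutoff_le[of _ y] by (intro sum.neutral) force
    then show ?thesis using True by simp
  next
    case False
    then have y: "norm y < 2 * R0" by (rule macro_cutoff_support[OF macro])
    with elim obtain i where i: "i \<in> {1..n}" "\<psi> (x i) R y = \<psi>0 y" by blast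
    let ?I = "{i\<in>{1..n}. \<psi> (x i) R y \<noteq> 0}"
    have "\<psi> (x i) R y \<le> (\<Sum>i=1..n. \<psi> (x i) R y)"
      using cutoff_le i(1) by (intro member_le_sum) auto
    moreover have "(\<Sum>i=1..n. \<psi> (x i) R y) = (\<Sum>i\<in>?I. \<psi> (x i) R y)"
      by (intro sum.mono_neutral_right) auto
    moreover have "(\<Sum>i\<in>?I. \<psi> (x i) R y) \<le> real (card ?I) * \<psi>0 y"
      using cutoff_le by (intro sum_bounded_above) auto
    moreover have "\<dots> \<le> K2 * \<psi>0 y"
      using card_active_cutoffs_le[OF R0 RR0 macro family cover y] cutoff_le[OF i(1), of y]
      by (intro mult_right_mono) auto
    ultimately show ?thesis using i(2) by linarith
  qed
qed

text \<open>Bounding every term separately gives the factor \<open>K2 (1 + n)\<close>, because \<open>(R0/R)\<^sup>2 \<le> n\<close>. The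
  contribution \<open>K2\<close> of the time derivative is compensated by the cut-off that coincides
  with \<open>\<psi>0\<close> near the given point: its Laplacian is at most of the size \<open>1/R0\<^sup>2\<close>, not \<open>1/R\<^sup>2\<close>.\<close>

lemma AE_cutoff_production_bound:
  assumes \<nu>: "0 < \<nu>" "R0\<^sup>2 / \<nu> \<le> T" and \<delta>: "1 / 2 \<le> \<delta>" "\<delta> < 1" and C0: "0 < C0"
    and time: "time_cutoff \<delta> C0 T \<eta>" and K2: "4 \<le> K2"
  shows "AE y in lborel. \<forall>t.
    \<bar>\<Sum>i=1..n. deriv \<eta> t * \<psi> (x i) R y + \<nu> * (\<eta> t * laplacian (\<psi> (x i) R) y)\<bar>
      \<le> real n * K2 * (\<nu> * C0 / R0\<^sup>2) * (\<eta> t * \<psi>0 y) powr (2 * \<delta> - 1)"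
proof -
  have R: "0 < R" by (rule optimal_covering_radius_pos[OF cover R0])
  have lc: "local_cutoff \<delta> C0 R0 \<psi>0 (x i) R (\<psi> (x i) R)" if "i \<in> {1..n}" for i
    by (rule covering_local_cutoff[OF R0 RR0 macro family cover that])
  have "AE y in lborel. \<bar>laplacian (\<psi> (x i) R) y\<bar> \<le> C0 / R\<^sup>2 * \<psi> (x i) R y powr (2 * \<delta> - 1)"
    if "i \<in> {1..n}" for i
    using lc[OF that] by (intro AE_laplacian_bound) (auto simp: local_cutoff_def)
  then have lap: "AE y in lborel. \<forall>i\<in>{1..n}.
      \<bar>laplacian (\<psi> (x i) R) y\<bar> \<le> C0 / R\<^sup>2 * \<psi> (x i) R y powr (2 * \<delta> - 1)"
    by (intro AE_finite_allI) auto
  have lap0: "AE y in lborel. \<bar>laplacian \<psi>0 y\<bar> \<le> C0 / R0\<^sup>2 * \<psi>0 y powr (2 * \<delta> - 1)"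
    using macro by (intro AE_laplacian_bound) (auto simp: macro_cutoff_def test_function_def)
  show ?thesis
    using lap lap0 AE_local_cutoff_eq_macro[OF R0 RR0 macro family cover]
  proof eventually_elim
    case (elim y)
    show ?case
    proof
      fix t
      let ?f = "\<lambda>i. \<psi> (x i) R y" and ?L = "\<lambda>i. laplacian (\<psi> (x i) R) y"
      define X where "X = (\<eta> t * \<psi>0 y) powr (2 * \<delta> - 1)"
      define D where "D = \<nu> * C0 / R0\<^sup>2"
      have X: "0 \<le> X" and D: "0 < D" unfolding X_def D_def using \<nu> C0 R0 by auto
      have \<eta>: "0 \<le> \<eta> t" "\<eta> t \<le> 1" using time by (auto simp: time_cutoff_def)
      have \<psi>01: "\<psi>0 y \<le> 1" "0 \<le> \<psi>0 y" using macro by (auto simp: macro_cutoff_def)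
      have T: "C0 / T \<le> D" and T0: "0 < T"
      proof -
        have "0 < R0\<^sup>2 / \<nu>" using R0 \<nu> by simp
        then show "0 < T" using \<nu>(2) by linarith
        then have "C0 / T \<le> C0 / (R0\<^sup>2 / \<nu>)"
          using \<open>0 < R0\<^sup>2 / \<nu>\<close> \<nu>(2) C0 by (intro divide_left_mono mult_pos_pos) auto
        then show "C0 / T \<le> D" by (simp add: D_def mult.commute)
      qed
      show "\<bar>\<Sum>i=1..n. deriv \<eta> t * ?f i + \<nu> * (\<eta> t * ?L i)\<bar> \<le> real n * K2 * D * X"
      proof (cases "\<psi>0 y = 0")
        case True
        have "?f i = 0 \<and> ?L i = 0" if "i \<in> {1..n}" for i
          using cutoff_le[OF that, of y] elim(1) that True by (auto dest!: bspec)
        then have "(\<Sum>i=1..n. deriv \<eta> t * ?f i + \<nu> * (\<eta> t * ?L i)) = 0"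
          by (intro sum.neutral) auto
        then show ?thesis using X D K2 by simp
      next
        case False
        then have y: "norm y < 2 * R0" by (rule macro_cutoff_support[OF macro])
        with elim(3) obtain j where j: "j \<in> {1..n}" "?f j = \<psi>0 y" "?L j = laplacian \<psi>0 y"
          "norm y < R0 \<Longrightarrow> ?L j = 0" by blast
        let ?I = "{i\<in>{1..n}. ?f i \<noteq> 0}"
        define \<rho> where "\<rho> = (R0 / R)\<^sup>2"
        \<comment> \<open>bounds the Laplacian term of the cut-off \<open>j\<close> in units of \<open>D X\<close>\<close>
        define e :: real where "e = (if norm y < R0 then 0 else 1)"
        have jI: "j \<in> ?I" using j False by auto
        have "(\<Sum>i=1..n. deriv \<eta> t * ?f i + \<nu> * (\<eta> t * ?L i))
            = (\<Sum>i\<in>?I. deriv \<eta> t * ?f i + \<nu> * (\<eta> t * ?L i))"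
        proof (rule sum.mono_neutral_right)
          show "\<forall>i\<in>{1..n} - ?I. deriv \<eta> t * ?f i + \<nu> * (\<eta> t * ?L i) = 0"
          proof
            fix i assume i: "i \<in> {1..n} - ?I"
            then have "?f i = 0" by auto
            moreover from this have "?L i = 0" using elim(1) i by (auto dest!: bspec)
            ultimately show "deriv \<eta> t * ?f i + \<nu> * (\<eta> t * ?L i) = 0" by simp
          qed
        qed auto
        also have "\<bar>\<dots>\<bar> \<le> real (card ?I) * (D * X) + (real (card ?I) - 1) * (\<rho> * (D * X)) + e * (D * X)"
        proof (rule abs_sum_le_with_exception[OF _ jI])
          fix i assume "i \<in> ?I"
          then have i: "i \<in> {1..n}" by simp
          note le = cutoff_le[OF i, of y]
          have "\<bar>deriv \<eta> t * ?f i\<bar> \<le> C0 / T * \<eta> t powr \<delta> * ?f i"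
            using mult_right_mono[OF time_cutoff_deriv_bound[OF time, of t], of "?f i"] le
            by (simp add: abs_mult)
          also have "\<dots> \<le> C0 / T * X"
            using powr_scale_bounds(1)[OF \<delta> \<eta>, of "?f i" "\<psi>0 y"] le \<psi>01 C0 T0
            unfolding X_def mult.assoc by (intro mult_left_mono) auto
          also have "\<dots> \<le> D * X" using T X by (rule mult_right_mono)
          finally show "\<bar>deriv \<eta> t * ?f i\<bar> \<le> D * X" .
          have "\<bar>\<nu> * (\<eta> t * ?L i)\<bar> = \<nu> * (\<eta> t * \<bar>?L i\<bar>)" using \<nu> \<eta> by (simp add: abs_mult)
          also have "\<dots> \<le> \<nu> * (\<eta> t * (C0 / R\<^sup>2 * ?f i powr (2 * \<delta> - 1)))"
            using elim(1) i \<nu> \<eta> by (intro mult_left_mono) auto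
          also have "\<dots> = \<rho> * D * (\<eta> t * ?f i powr (2 * \<delta> - 1))"
            using R0 R by (simp add: \<rho>_def D_def power_divide)
          also have "\<dots> \<le> \<rho> * D * X"
            using powr_scale_bounds(2)[OF \<delta> \<eta>, of "?f i" "\<psi>0 y"] le \<psi>01 D
            unfolding X_def by (intro mult_left_mono) (auto simp: \<rho>_def)
          finally show "\<bar>\<nu> * (\<eta> t * ?L i)\<bar> \<le> \<rho> * (D * X)" by (simp add: mult.assoc)
        next
          show "\<bar>\<nu> * (\<eta> t * ?L j)\<bar> \<le> e * (D * X)"
          proof (cases "norm y < R0")
            case True
            then show ?thesis using j(4) by (simp add: e_def)
          next
            case False
            have "\<bar>\<nu> * (\<eta> t * ?L j)\<bar> = \<nu> * (\<eta> t * \<bar>?L j\<bar>)" using \<nu> \<eta> by (simp add: abs_mult)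
            also have "\<dots> \<le> \<nu> * (\<eta> t * (C0 / R0\<^sup>2 * \<psi>0 y powr (2 * \<delta> - 1)))"
              using elim(2) \<nu> \<eta> unfolding j(3) by (intro mult_left_mono) auto
            also have "\<dots> = D * (\<eta> t * \<psi>0 y powr (2 * \<delta> - 1))" by (simp add: D_def)
            also have "\<dots> \<le> D * X"
              using powr_scale_bounds(2)[OF \<delta> \<eta>, of "\<psi>0 y" "\<psi>0 y"] \<psi>01 D
              unfolding X_def by (intro mult_left_mono) auto
            finally show ?thesis using False by (simp add: e_def)
          qed
        qed simp
        also have "\<dots> = (real (card ?I) + (real (card ?I) - 1) * \<rho> + e) * (D * X)"
          by (simp add: algebra_simps)
        also have "\<dots> \<le> real n * K2 * (D * X)"
        proof (intro mult_right_mono production_count)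
          show "1 \<le> card ?I" using jI card_gt_0_iff[of ?I] by (simp add: Suc_le_eq) blast
          show "real (card ?I) \<le> K2" by (rule card_active_cutoffs_le[OF R0 RR0 macro family cover y])
          show "\<rho> \<le> real n" using cover unfolding \<rho>_def optimal_covering_def by blast
          have sub: "?I \<subseteq> {1..n}" by blast
          show cn: "card ?I \<le> n" using card_mono[OF _ sub] by simp
          show "e = 0 \<or> e = 1 \<and> (card ?I < n \<or> \<rho> \<le> 3)"
          proof (cases "norm y < R0 \<or> card ?I < n")
            case False
            with cn have "card ?I = card {1..n}" by simp
            then have "?I = {1..n}" by (intro card_subset_eq sub) auto
            then have all: "?f i \<noteq> 0" if "i \<in> {1..n}" for i using that by blast
            have "2 * R0 \<le> 3 * R"
              by (rule all_active_outside_imp_large_radius[OF R0 RR0 macro family cover _ y all]) (use False in auto)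
            then have "R0 / R \<le> 3 / 2" using R by (simp add: field_simps)
            then have "\<rho> \<le> (3 / 2)\<^sup>2" unfolding \<rho>_def using R0 R by (intro power_mono) auto
            then show ?thesis using False by (simp add: e_def power2_eq_square)
          qed (auto simp: e_def)
        qed (use K2 X D in auto)
        finally show ?thesis by (simp add: mult.assoc)
      qed
    qed
  qed
qed

end

section \<open>The bounds on the averaged flux\<close>

lemma AE_lborel_snd:
  assumes "AE y in lborel. P (y :: 'b::euclidean_space)"
  shows "AE z in (lborel :: ('a::euclidean_space \<times> 'b) measure). P (snd z)"
proof -
  obtain N where N: "\<And>y. y \<in> space lborel - N \<Longrightarrow> P y" "N \<in> null_sets lborel"
    by (rule AE_E3[OF assms]) blast
  have "emeasure (lborel \<Otimes>\<^sub>M lborel) ((UNIV :: 'a set) \<times> N) = 0"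
    using N(2) by (subst lborel.emeasure_pair_measure_Times) auto
  moreover have "(UNIV :: 'a set) \<times> N \<in> sets (lborel \<Otimes>\<^sub>M lborel)"
    using N(2) by (intro pair_measureI) auto
  ultimately have "(UNIV :: 'a set) \<times> N \<in> null_sets (lborel \<Otimes>\<^sub>M lborel)" by (rule null_setsI)
  then have "(UNIV :: 'a set) \<times> N \<in> null_sets (lborel :: ('a \<times> 'b) measure)"
    unfolding lborel_prod .
  from AE_not_in[OF this] show ?thesis
  proof eventually_elim
    case (elim z)
    then have "snd z \<in> space lborel - N" by (auto simp: mem_Times_iff)
    then show ?case by (rule N(1))
  qed
qed

text \<open>Here \<open>I\<close> is the analogue of \<open>P0\<close> with \<open>\<psi>0\<close> replaced by the sum of the local cut-offs. The
  theorem follows from this estimate by arithmetic: the condition on \<open>R\<close> says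
  \<open>E0 / R\<^sup>2 \<le> \<gamma>\<^sup>2 P0 / (C0 K1 K2)\<close>, so the error is at most \<open>\<gamma>\<^sup>2 / K1\<close> times \<open>\<nu> P0\<close>.\<close>

lemma averaged_flux_near_dissipation:
  fixes \<nu> R0 T \<delta> C0 K1 K2 R :: real
  assumes \<nu>: "0 < \<nu>" and \<Omega>: "open \<Omega>" and R0: "0 < R0" "ball 0 (3 * R0) \<subseteq> \<Omega>"
    and NS: "NS_solution \<nu> \<Omega> u p"
    and \<delta>: "1 / 2 \<le> \<delta>" "\<delta> < 1" and C0: "0 < C0"
    and macro: "macro_cutoff \<delta> C0 R0 \<psi>0" and time: "time_cutoff \<delta> C0 T \<eta>"
    and family: "cutoff_family \<delta> C0 R0 \<psi>0 \<psi>" and K2: "4 \<le> K2" and T: "R0\<^sup>2 / \<nu> \<le> T"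
    and RR0: "R \<le> R0" and cover: "optimal_covering K1 K2 R0 R n x"
  defines "E0 \<equiv> enstrophy0 \<Omega> u \<delta> T R0 (cutoff \<eta> \<psi>0)"
    and "P0 \<equiv> palinstrophy0 \<Omega> u T R0 (cutoff \<eta> \<psi>0)"
  shows "\<exists>I. P0 \<le> I \<and> I \<le> K2 * P0 \<and>
    \<bar>averaged_flux \<Omega> u T \<eta> \<psi> R n x - R0\<^sup>2 / (real n * R\<^sup>2) * (\<nu> * I)\<bar> \<le> \<nu> * K2 * C0 * E0 / R\<^sup>2"
proof -
  have R: "0 < R" by (rule optimal_covering_radius_pos[OF cover R0(1)])
  have "0 < R0\<^sup>2 / \<nu>" using R0 \<nu> by simp
  with T have T0: "0 < T" by linarith
  have n: "0 < real n"
  proof -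
    have "0 < (R0 / R)\<^sup>2" using R R0 by simp
    also have "(R0 / R)\<^sup>2 \<le> real n" using cover unfolding optimal_covering_def by blast
    finally show ?thesis .
  qed
  let ?G = "\<lambda>z. (norm (grad (curl (u (fst z))) (snd z)))\<^sup>2"
  let ?E = "\<lambda>z. 1 / 2 * \<bar>curl (u (fst z)) (snd z)\<bar>\<^sup>2"
  let ?\<psi> = "\<lambda>i. \<psi> (x i) R"
  let ?g = "\<lambda>f z. \<eta> (fst z) * f (snd z)"
  let ?h = "\<lambda>f z. deriv \<eta> (fst z) * f (snd z) + \<nu> * (\<eta> (fst z) * laplacian f (snd z))"
  let ?X = "\<lambda>z. (\<eta> (fst z) * \<psi>0 (snd z)) powr (2 * \<delta> - 1)"
  let ?D = "real n * K2 * (\<nu> * C0 / R0\<^sup>2)"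
  have t\<eta>: "test_function {0<..<2 * T} \<eta>" and \<eta>01: "\<And>t. 0 \<le> \<eta> t" "\<And>t. \<eta> t \<le> 1"
    using time by (auto simp: time_cutoff_def)
  have t\<psi>0: "test_function (ball 0 (2 * R0)) \<psi>0" and \<psi>01: "\<And>y. 0 \<le> \<psi>0 y" "\<And>y. \<psi>0 y \<le> 1"
    using macro by (auto simp: macro_cutoff_def)
  have B: "ball 0 (2 * R0) \<subseteq> \<Omega>" using R0 by (intro order_trans[OF subset_ball R0(2)]) auto
  have lc: "local_cutoff \<delta> C0 R0 \<psi>0 (x i) R (?\<psi> i)" if "i \<in> {1..n}" for i
    by (rule covering_local_cutoff[OF R0(1) RR0 macro family cover that])
  have test: "test_function \<Omega> (?\<psi> i)" if "i \<in> {1..n}" for i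
    using lc[OF that] by (intro test_function_dominated[OF t\<psi>0 _ B]) (auto simp: local_cutoff_def)
  have test0: "test_function \<Omega> \<psi>0"
    using \<psi>01 t\<psi>0 by (intro test_function_dominated[OF t\<psi>0 _ B]) (auto simp: test_function_def)
  note balance = time_integrated_flux[OF NS \<Omega> t\<eta>]

  let ?K = "closure {t. \<eta> t \<noteq> 0} \<times> closure {y. \<psi>0 y \<noteq> 0}"
  have K: "compact ?K" "?K \<subseteq> {0<..} \<times> \<Omega>" "?K \<subseteq> {0<..<2 * T} \<times> \<Omega>"
    using t\<eta> test0 unfolding test_function_def by (auto intro!: compact_Times)
  have off: "\<eta> (fst z) * \<psi>0 (snd z) = 0" if "z \<notin> ?K" for z
    using that dderiv_outside_support(1)[of "fst z" \<eta>] dderiv_outside_support(1)[of "snd z" \<psi>0]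
    by (auto simp: mem_Times_iff)
  have intX: "integrable lborel (\<lambda>z. ?E z * ?X z)"
  proof (rule integrable_mult_supported[OF K(1), where B = 1])
    show "continuous_on ?K ?E"
      by (rule continuous_on_subset[OF continuous_on_enstrophy_density(1)[OF NS \<Omega>] K(2)])
    have c: "continuous_on UNIV \<eta>" "continuous_on UNIV \<psi>0"
      using t\<eta> t\<psi>0 by (auto simp: test_function_def smooth_on_continuous)
    have "continuous_on UNIV (\<lambda>z::real \<times> plane. \<eta> (fst z) * \<psi>0 (snd z))"
      by (intro continuous_on_mult continuous_on_compose2[OF c(1)] continuous_on_compose2[OF c(2)]
          continuous_on_fst continuous_on_snd continuous_on_id subset_UNIV)
    then have "(\<lambda>z::real \<times> plane. \<eta> (fst z) * \<psi>0 (snd z)) \<in> borel_measurable borel"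
      by (rule borel_measurable_continuous_onI)
    then show "?X \<in> borel_measurable borel" by measurable
    have "?X z \<le> 1" for z :: "real \<times> plane"
      using powr_mono2[of "2 * \<delta> - 1" "\<eta> (fst z) * \<psi>0 (snd z)" 1] \<delta> \<eta>01 \<psi>01
      by (simp add: mult_le_one)
    then show "\<bar>?X z\<bar> \<le> 1" for z by simp
    show "?X z = 0" if "z \<notin> ?K" for z using off[OF that] by simp
  qed
  have E0: "integral\<^sup>L lborel (\<lambda>z. ?E z * ?X z) = T * R0\<^sup>2 * E0"
  proof -
    have "(LINT t:{0<..<2 * T}|lborel. LINT y:\<Omega>|lborel.
        1 / 2 * \<bar>curl (u t) y\<bar>\<^sup>2 * cutoff \<eta> \<psi>0 t y powr (2 * \<delta> - 1)) = integral\<^sup>L lborel (\<lambda>z. ?E z * ?X z)"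
    proof (rule iterated_set_integral_eq_integral(1)[OF intX])
      fix t y assume "t \<notin> {0<..<2 * T} \<or> y \<notin> \<Omega>"
      then have "(t, y) \<notin> ?K" using K(3) by blast
      then show "?E (t, y) * ?X (t, y) = 0" using off[of "(t, y)"] by simp
    qed (simp add: cutoff_def)
    then show ?thesis using T0 R0 by (simp add: E0_def enstrophy0_def)
  qed
  have P0: "integral\<^sup>L lborel (\<lambda>z. ?G z * ?g \<psi>0 z) = T * R0\<^sup>2 * P0"
  proof -
    have "(LINT t:{0<..<2 * T}|lborel. LINT y:\<Omega>|lborel.
        (norm (grad (curl (u t)) y))\<^sup>2 * cutoff \<eta> \<psi>0 t y) = integral\<^sup>L lborel (\<lambda>z. ?G z * ?g \<psi>0 z)"
    proof (rule iterated_set_integral_eq_integral(1)[OF balance(3)[OF test0]])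
      fix t y assume "t \<notin> {0<..<2 * T} \<or> y \<notin> \<Omega>"
      then have "(t, y) \<notin> ?K" using K(3) by blast
      then show "?G (t, y) * ?g \<psi>0 (t, y) = 0" using off[of "(t, y)"] by simp
    qed (simp add: cutoff_def)
    then show ?thesis using T0 R0 by (simp add: P0_def palinstrophy0_def)
  qed

  define J where "J = (\<Sum>i=1..n. \<integral>z. ?G z * ?g (?\<psi> i) z \<partial>lborel)"
  define H where "H = (\<Sum>i=1..n. \<integral>z. ?E z * ?h (?\<psi> i) z \<partial>lborel)"
  have avg: "averaged_flux \<Omega> u T \<eta> \<psi> R n x = 1 / (T * (real n * R\<^sup>2)) * (\<nu> * J - H)"
  proof -
    have "(LINT t:{0<..<2 * T}|lborel. 1 / real n * (\<Sum>i=1..n. 1 / R\<^sup>2 * flux \<Omega> u (cutoff \<eta> (?\<psi> i)) t))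
        = 1 / real n * (LINT t:{0<..<2 * T}|lborel. (\<Sum>i=1..n. 1 / R\<^sup>2 * flux \<Omega> u (cutoff \<eta> (?\<psi> i)) t))"
      by (rule set_integral_mult_right)
    also have "(LINT t:{0<..<2 * T}|lborel. (\<Sum>i=1..n. 1 / R\<^sup>2 * flux \<Omega> u (cutoff \<eta> (?\<psi> i)) t))
        = (\<Sum>i=1..n. LINT t:{0<..<2 * T}|lborel. 1 / R\<^sup>2 * flux \<Omega> u (cutoff \<eta> (?\<psi> i)) t)"
      unfolding set_lebesgue_integral_def scaleR_sum_right
      by (intro Bochner_Integration.integral_sum set_integrable_mult_right[unfolded set_integrable_def]
          balance(1)[OF test, unfolded set_integrable_def])
    also have "\<dots> = (\<Sum>i=1..n. 1 / R\<^sup>2 * (LINT t:{0<..<2 * T}|lborel. flux \<Omega> u (cutoff \<eta> (?\<psi> i)) t))"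
      by (intro sum.cong refl set_integral_mult_right)
    also have "\<dots> = (\<Sum>i=1..n. 1 / R\<^sup>2 * (\<nu> * (\<integral>z. ?G z * ?g (?\<psi> i) z \<partial>lborel)
        - (\<integral>z. ?E z * ?h (?\<psi> i) z \<partial>lborel)))"
      by (intro sum.cong refl arg_cong2[where f = "(*)"] balance(2)[OF test])
    also have "\<dots> = 1 / R\<^sup>2 * (\<nu> * J - H)"
      by (simp add: J_def H_def sum_distrib_left sum_subtractf right_diff_distrib)
    finally show ?thesis by (simp add: averaged_flux_def)
  qed

  have AEs: "AE z in (lborel :: (real \<times> plane) measure).
      \<psi>0 (snd z) \<le> (\<Sum>i=1..n. ?\<psi> i (snd z)) \<and> (\<Sum>i=1..n. ?\<psi> i (snd z)) \<le> K2 * \<psi>0 (snd z)"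
    using AE_sum_cutoffs[OF R0(1) RR0 macro family cover] by (rule AE_lborel_snd)
  have AEp: "AE z in (lborel :: (real \<times> plane) measure).
      \<bar>\<Sum>i=1..n. ?h (?\<psi> i) z\<bar> \<le> ?D * ?X z"
  proof -
    have "AE z in (lborel :: (real \<times> plane) measure). \<forall>t.
        \<bar>\<Sum>i=1..n. deriv \<eta> t * ?\<psi> i (snd z) + \<nu> * (\<eta> t * laplacian (?\<psi> i) (snd z))\<bar>
        \<le> ?D * (\<eta> t * \<psi>0 (snd z)) powr (2 * \<delta> - 1)"
      using AE_cutoff_production_bound[OF R0(1) RR0 macro family cover \<nu> T \<delta> C0 time K2] by (rule AE_lborel_snd)
    then show ?thesis by eventually_elim auto
  qed
  have intJ: "integrable lborel (\<lambda>z. \<Sum>i=1..n. ?G z * ?g (?\<psi> i) z)"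
    by (intro Bochner_Integration.integrable_sum balance(3)[OF test])
  have J_eq: "J = (\<integral>z. (\<Sum>i=1..n. ?G z * ?g (?\<psi> i) z) \<partial>lborel)"
    unfolding J_def by (intro Bochner_Integration.integral_sum[symmetric] balance(3)[OF test])
  have sumG: "(\<Sum>i=1..n. ?G z * ?g (?\<psi> i) z) = ?G z * \<eta> (fst z) * (\<Sum>i=1..n. ?\<psi> i (snd z))" for z
    by (simp add: sum_distrib_left mult.assoc)
  have J_lower: "T * R0\<^sup>2 * P0 \<le> J"
    unfolding P0[symmetric] J_eq
  proof (rule integral_mono_AE[OF balance(3)[OF test0] intJ])
    show "AE z in lborel. ?G z * ?g \<psi>0 z \<le> (\<Sum>i=1..n. ?G z * ?g (?\<psi> i) z)"
      using AEs unfolding sumG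
    proof eventually_elim
      case (elim z)
      then have "(?G z * \<eta> (fst z)) * \<psi>0 (snd z) \<le> (?G z * \<eta> (fst z)) * (\<Sum>i=1..n. ?\<psi> i (snd z))"
        using \<eta>01 by (intro mult_left_mono) auto
      then show ?case by (simp add: mult.assoc)
    qed
  qed
  have J_upper: "J \<le> K2 * (T * R0\<^sup>2 * P0)"
  proof -
    have "J \<le> (\<integral>z. K2 * (?G z * ?g \<psi>0 z) \<partial>lborel)"
      unfolding J_eq
    proof (rule integral_mono_AE[OF intJ integrable_mult_right[OF balance(3)[OF test0]]])
      show "AE z in lborel. (\<Sum>i=1..n. ?G z * ?g (?\<psi> i) z) \<le> K2 * (?G z * ?g \<psi>0 z)"
        using AEs unfolding sumG
      proof eventually_elim
        case (elim z)
        then have "(?G z * \<eta> (fst z)) * (\<Sum>i=1..n. ?\<psi> i (snd z)) \<le> (?G z * \<eta> (fst z)) * (K2 * \<psi>0 (snd z))"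
          using \<eta>01 by (intro mult_left_mono) auto
        then show ?case by (simp add: mult_ac)
      qed
    qed
    also have "\<dots> = K2 * (T * R0\<^sup>2 * P0)" unfolding P0[symmetric] by (rule integral_mult_right_zero)
    finally show ?thesis .
  qed
  have H_bound: "\<bar>H\<bar> \<le> ?D * (T * R0\<^sup>2 * E0)"
  proof -
    have intH: "integrable lborel (\<lambda>z. \<Sum>i=1..n. ?E z * ?h (?\<psi> i) z)"
      by (intro Bochner_Integration.integrable_sum balance(4)[OF test])
    have "H = (\<integral>z. (\<Sum>i=1..n. ?E z * ?h (?\<psi> i) z) \<partial>lborel)"
      unfolding H_def by (intro Bochner_Integration.integral_sum[symmetric] balance(4)[OF test])
    then have "\<bar>H\<bar> \<le> (\<integral>z. \<bar>\<Sum>i=1..n. ?E z * ?h (?\<psi> i) z\<bar> \<partial>lborel)"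
      by (simp only: integral_abs_bound)
    also have "\<dots> \<le> (\<integral>z. ?D * (?E z * ?X z) \<partial>lborel)"
    proof (rule integral_mono_AE[OF integrable_abs[OF intH] integrable_mult_right[OF intX]])
      show "AE z in lborel. \<bar>\<Sum>i=1..n. ?E z * ?h (?\<psi> i) z\<bar> \<le> ?D * (?E z * ?X z)"
        using AEp
      proof eventually_elim
        case (elim z)
        have "\<bar>\<Sum>i=1..n. ?E z * ?h (?\<psi> i) z\<bar> = ?E z * \<bar>\<Sum>i=1..n. ?h (?\<psi> i) z\<bar>"
          unfolding sum_distrib_left[symmetric] abs_mult by simp
        also have "\<dots> \<le> ?E z * (?D * ?X z)" using elim by (intro mult_left_mono) auto
        finally show ?case by (simp only: mult_ac)
      qed
    qed
    also have "\<dots> = ?D * (T * R0\<^sup>2 * E0)" unfolding E0[symmetric] by (rule integral_mult_right_zero)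
    finally show ?thesis .
  qed

  define I where "I = J / (T * R0\<^sup>2)"
  have TR: "0 < T * R0\<^sup>2" using T0 R0 by simp
  have J: "J = T * R0\<^sup>2 * I" using T0 R0 by (simp add: I_def)
  show ?thesis
  proof (intro exI conjI)
    show "P0 \<le> I" using J_lower unfolding J by (simp only: mult_le_cancel_left_pos[OF TR])
    show "I \<le> K2 * P0" using J_upper unfolding J mult.left_commute[of K2]
      by (simp only: mult_le_cancel_left_pos[OF TR])
    have "averaged_flux \<Omega> u T \<eta> \<psi> R n x - R0\<^sup>2 / (real n * R\<^sup>2) * (\<nu> * I) = - (H / (T * (real n * R\<^sup>2)))"
      unfolding avg J using T0 R n by (simp add: field_simps)
    then have "\<bar>averaged_flux \<Omega> u T \<eta> \<psi> R n x - R0\<^sup>2 / (real n * R\<^sup>2) * (\<nu> * I)\<bar>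
        = \<bar>H\<bar> / (T * (real n * R\<^sup>2))"
      using T0 n by simp
    also have "\<dots> \<le> ?D * (T * R0\<^sup>2 * E0) / (T * (real n * R\<^sup>2))"
      using H_bound T0 n by (intro divide_right_mono) auto
    also have "\<dots> = \<nu> * K2 * C0 * E0 / R\<^sup>2" using T0 R R0 n by (simp add: field_simps)
    finally show "\<bar>averaged_flux \<Omega> u T \<eta> \<psi> R n x - R0\<^sup>2 / (real n * R\<^sup>2) * (\<nu> * I)\<bar>
      \<le> \<nu> * K2 * C0 * E0 / R\<^sup>2" .
  qed
qed

theorem theorem4p1:
  fixes \<nu> R0 T \<delta> C0 K1 K2 \<gamma> E0 P0 \<sigma>0 c :: real
    and \<Omega> :: "plane set"
    and u :: "real \<Rightarrow> plane \<Rightarrow> plane"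
    and p :: "real \<Rightarrow> plane \<Rightarrow> real"
    and \<eta> :: "real \<Rightarrow> real"
    and \<psi>0 :: "plane \<Rightarrow> real"
    and \<psi> :: "plane \<Rightarrow> real \<Rightarrow> plane \<Rightarrow> real"
  defines "E0 \<equiv> enstrophy0 \<Omega> u \<delta> T R0 (cutoff \<eta> \<psi>0)"
    and "P0 \<equiv> palinstrophy0 \<Omega> u T R0 (cutoff \<eta> \<psi>0)"
    and "\<sigma>0 \<equiv> sqrt (E0 / P0)"
    and "c \<equiv> 1 / sqrt (C0 * K1 * K2)"
  assumes "0 < \<nu>"
    and "open \<Omega>" and "bounded \<Omega>" and "connected \<Omega>"
    and "0 < R0" and "ball 0 (3 * R0) \<subseteq> \<Omega>"
    and "NS_solution \<nu> \<Omega> u p"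
    and "1 / 2 \<le> \<delta>" and "\<delta> < 1" and "0 < C0"
    and "macro_cutoff \<delta> C0 R0 \<psi>0"
    and "time_cutoff \<delta> C0 T \<eta>"
    and "cutoff_family \<delta> C0 R0 \<psi>0 \<psi>"
    and "1 < K1" and "1 < K2"
    and "\<And>R. 0 < R \<Longrightarrow> R \<le> R0 \<Longrightarrow> \<exists>n x. optimal_covering K1 K2 R0 R n x"
    and "0 < \<gamma>" and "\<gamma> < 1"
    and "R0\<^sup>2 / \<nu> \<le> T"
    and "0 < P0"
    and "\<sigma>0 < c * \<gamma> * R0"
  shows "\<forall>R n x.
    1 / (c * \<gamma>) * \<sigma>0 \<le> R \<and> R \<le> R0 \<and> optimal_covering K1 K2 R0 R n x \<longrightarrow>
      (1 - \<gamma>\<^sup>2) / K1 * (\<nu> * P0) \<le> averaged_flux \<Omega> u T \<eta> \<psi> R n x \<and>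
      averaged_flux \<Omega> u T \<eta> \<psi> R n x \<le> K2 * (1 + \<gamma>\<^sup>2 / (K1 * K2)) * (\<nu> * P0)"
proof (intro allI impI)
  fix R n x
  assume A: "1 / (c * \<gamma>) * \<sigma>0 \<le> R \<and> R \<le> R0 \<and> optimal_covering K1 K2 R0 R n x"
  then have RR0: "R \<le> R0" and cover: "optimal_covering K1 K2 R0 R n x" by auto
  note \<nu> = \<open>0 < \<nu>\<close> and R0 = \<open>0 < R0\<close> and C0 = \<open>0 < C0\<close> and K = \<open>1 < K1\<close> \<open>1 < K2\<close> and P0 = \<open>0 < P0\<close>
  have R: "0 < R" by (rule optimal_covering_radius_pos[OF cover R0])
  have K2: "4 \<le> K2" by (rule four_le_multiplicity_bound[OF R0 assms(20)])
  let ?F = "averaged_flux \<Omega> u T \<eta> \<psi> R n x"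
  define r where "r = R0\<^sup>2 / (real n * R\<^sup>2)"
  obtain I where I: "P0 \<le> I" "I \<le> K2 * P0"
    and F: "\<bar>?F - r * (\<nu> * I)\<bar> \<le> \<nu> * K2 * C0 * E0 / R\<^sup>2"
    using averaged_flux_near_dissipation[OF \<nu> \<open>open \<Omega>\<close> R0 \<open>ball 0 (3 * R0) \<subseteq> \<Omega>\<close> \<open>NS_solution \<nu> \<Omega> u p\<close>
        \<open>1 / 2 \<le> \<delta>\<close> \<open>\<delta> < 1\<close> C0 \<open>macro_cutoff \<delta> C0 R0 \<psi>0\<close> \<open>time_cutoff \<delta> C0 T \<eta>\<close>
        \<open>cutoff_family \<delta> C0 R0 \<psi>0 \<psi>\<close> K2 \<open>R0\<^sup>2 / \<nu> \<le> T\<close> RR0 cover]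
    unfolding E0_def P0_def r_def by blast
  have r: "1 / K1 \<le> r" "r \<le> 1"
  proof -
    have q: "(R0 / R)\<^sup>2 \<le> real n" "real n \<le> K1 * (R0 / R)\<^sup>2"
      using cover unfolding optimal_covering_def by blast+
    have "0 < (R0 / R)\<^sup>2" using R R0 by simp
    with q(1) have n: "0 < real n" by linarith
    show "1 / K1 \<le> r" "r \<le> 1"
      using q n R K unfolding r_def by (simp_all add: field_simps power_divide)
  qed
  have K12: "0 < C0 * K1 * K2" using C0 K by simp
  have c: "0 < c" "c\<^sup>2 = 1 / (C0 * K1 * K2)" using K12 by (simp_all add: c_def power_divide)
  have "\<sigma>0 \<le> c * \<gamma> * R" using A c(1) \<open>0 < \<gamma>\<close> by (simp add: field_simps)
  then have "E0 / P0 \<le> (c * \<gamma> * R)\<^sup>2" unfolding \<sigma>0_def by (rule sqrt_le_D)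
  then have "E0 \<le> (\<gamma>\<^sup>2 * R\<^sup>2 / (C0 * K1 * K2)) * P0"
    using P0 c(2) by (simp add: power_mult_distrib pos_divide_le_eq)
  then have "\<nu> * K2 * C0 / R\<^sup>2 * E0 \<le> \<nu> * K2 * C0 / R\<^sup>2 * ((\<gamma>\<^sup>2 * R\<^sup>2 / (C0 * K1 * K2)) * P0)"
    using \<nu> K C0 by (intro mult_left_mono) auto
  also have "\<dots> = \<gamma>\<^sup>2 / K1 * (\<nu> * P0)" using K C0 R by (simp add: field_simps)
  finally have error: "\<bar>?F - r * (\<nu> * I)\<bar> \<le> \<gamma>\<^sup>2 / K1 * (\<nu> * P0)" using F by simp
  have r0: "0 \<le> r" unfolding r_def by simp
  have "1 / K1 * (\<nu> * P0) \<le> r * (\<nu> * I)"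
    using r0 r I \<nu> P0 K by (intro mult_mono) auto
  moreover have "r * (\<nu> * I) \<le> 1 * (\<nu> * (K2 * P0))"
    using r0 r I \<nu> P0 K by (intro mult_mono mult_nonneg_nonneg) auto
  moreover have "(1 - \<gamma>\<^sup>2) / K1 * (\<nu> * P0) = 1 / K1 * (\<nu> * P0) - \<gamma>\<^sup>2 / K1 * (\<nu> * P0)"
    by (simp add: diff_divide_distrib left_diff_distrib)
  moreover have "K2 * (1 + \<gamma>\<^sup>2 / (K1 * K2)) * (\<nu> * P0) = 1 * (\<nu> * (K2 * P0)) + \<gamma>\<^sup>2 / K1 * (\<nu> * P0)"
    using K by (simp add: field_simps)
  ultimately have "(1 - \<gamma>\<^sup>2) / K1 * (\<nu> * P0) \<le> ?F"
    "?F \<le> K2 * (1 + \<gamma>\<^sup>2 / (K1 * K2)) * (\<nu> * P0)"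
    using error unfolding abs_le_iff by linarith+
  then show "(1 - \<gamma>\<^sup>2) / K1 * (\<nu> * P0) \<le> ?F \<and> ?F \<le> K2 * (1 + \<gamma>\<^sup>2 / (K1 * K2)) * (\<nu> * P0)"
    by (rule conjI)
qed

end
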